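(* Any finite multiplicative Lie algebra $G$ has at least one cover $G^*$.
   Context: A multiplicative Lie algebra is a triple $(G,\cdot,\star)$ where $(G,\cdot)$ is a group (not necessarily abelian) and $\star$ is a binary operation on $G$ such that for all $x,y,z\in G$, writing ${}^xy=xyx^{-1}$: (1) $x\star x=1$; (2) $x\star(yz)=(x\star y)\,{}^y(x\star z)$; (3) $(xy)\star z={}^x(y\star z)\,(x\star z)$; (4) $((x\star y)\star{}^yz)((y\star z)\star{}^zx)((z\star x)\star{}^xy)=1$; (5) ${}^z(x\star y)={}^zx\star{}^zy$. An ideal is a normal subgroup $H$ with $x\star y\in H$ for all $x\in G$, $y\in H$. Homomorphisms are group homomorphisms preserving $\star$. For ideals $A,B$ of a multiplicative Lie algebra, at least one of which is the whole algebra, ${}^M[A,B]=(A\star B)[A,B]$, where $A\star B$ (resp. $[A,B]$) is the subgroup generated by all $a\star b$ (resp. $[a,b]=aba^{-1}b^{-1}$), $a\in A$, $b\in B$; it is an ideal. $Z(G)$ is the group center, $LZ(G)=\{x\in G: x\star y=1\ \forall y\in G\}$, $\mathcal{Z}(G)=LZ(G)\cap Z(G)$. The Schur multiplier of $G$ is $\tilde M(G)=({}^M[F,F]\cap R)/{}^M[R,F]$ for any free presentation $1\to R\to F\to G\to1$ (short exact sequence of multiplicative Lie algebras with $F$ a free multiplicative Lie algebra on a set); it is independent of the presentation up to isomorphism. A central extension $1\to N\to G^*\to G\to1$ is a short exact sequence of multiplicative Lie algebras with $N\subseteq\mathcal{Z}(G^* )$. It is a stem extension if $N\subseteq{}^M[G^*,G^*]$,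 and a stem cover if in addition $N\cong\tilde M(G)$; in that case $G^*$ is called a cover of $G$. *)

theory Defs
  imports "HOL-Algebra.Coset" "HOL-Algebra.Generated_Groups"
begin

section \<open>Multiplicative Lie algebras\<close>

record 'a mla = "'a monoid" +
  star :: "'a \<Rightarrow> 'a \<Rightarrow> 'a" (infixl "\<star>\<index>" 70)

definition conjugate :: "('a, 'b) monoid_scheme \<Rightarrow> 'a \<Rightarrow> 'a \<Rightarrow> 'a" (infixr "\<triangleright>\<index>" 75)
  where "x \<triangleright>\<^bsub>G\<^esub> y = x \<otimes>\<^bsub>G\<^esub> y \<otimes>\<^bsub>G\<^esub> inv\<^bsub>G\<^esub> x"

locale mult_lie_algebra = group G for G :: "('a, 'b) mla_scheme" (structure) +
  assumes star_closed [intro, simp]: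
      "\<lbrakk>x \<in> carrier G; y \<in> carrier G\<rbrakk> \<Longrightarrow> x \<star> y \<in> carrier G"
    and star_self:
      "x \<in> carrier G \<Longrightarrow> x \<star> x = \<one>"
    and star_mult_right:
      "\<lbrakk>x \<in> carrier G; y \<in> carrier G; z \<in> carrier G\<rbrakk>
        \<Longrightarrow> x \<star> (y \<otimes> z) = (x \<star> y) \<otimes> (y \<triangleright> (x \<star> z))"
    and star_mult_left:
      "\<lbrakk>x \<in> carrier G; y \<in> carrier G; z \<in> carrier G\<rbrakk>
        \<Longrightarrow> (x \<otimes> y) \<star> z = (x \<triangleright> (y \<star> z)) \<otimes> (x \<star> z)"
    and star_jacobi:
      "\<lbrakk>x \<in> carrier G; y \<in> carrier G; z \<in> carrier G\<rbrakk>
        \<Longrightarrow> ((x \<star> y) \<star> (y \<triangleright> z)) \<otimes> ((y \<star> z) \<star> (z \<triangleright> x)) \<otimes> ((z \<star> x) \<star> (x \<triangleright> y)) = \<one>"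
    and conjugate_star:
      "\<lbrakk>x \<in> carrier G; y \<in> carrier G; z \<in> carrier G\<rbrakk>
        \<Longrightarrow> z \<triangleright> (x \<star> y) = (z \<triangleright> x) \<star> (z \<triangleright> y)"

definition mla_hom :: "('a, 'b) mla_scheme \<Rightarrow> ('c, 'd) mla_scheme \<Rightarrow> ('a \<Rightarrow> 'c) set"
  where "mla_hom G H =
    {h \<in> hom G H. \<forall>x\<in>carrier G. \<forall>y\<in>carrier G. h (x \<star>\<^bsub>G\<^esub> y) = h x \<star>\<^bsub>H\<^esub> h y}"

definition mla_is_iso :: "('a, 'b) mla_scheme \<Rightarrow> ('c, 'd) mla_scheme \<Rightarrow> bool" (infix "\<cong>\<^sub>M" 60)
  where "G \<cong>\<^sub>M H \<longleftrightarrow> (\<exists>h \<in> mla_hom G H. bij_betw h (carrier G) (carrier H))"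

text \<open>The factor structure is used only for ideals, where the union below is a single coset.\<close>

definition mla_quotient :: "('a, 'b) mla_scheme \<Rightarrow> 'a set \<Rightarrow> 'a set mla" (infixl "Mod\<^sub>M" 65)
  where "G Mod\<^sub>M H =
    \<lparr>carrier = rcosets\<^bsub>G\<^esub> H, mult = set_mult G, one = H,
     star = (\<lambda>A B. \<Union>a\<in>A. \<Union>b\<in>B. H #>\<^bsub>G\<^esub> (a \<star>\<^bsub>G\<^esub> b))\<rparr>"

definition star_subgroup :: "('a, 'b) mla_scheme \<Rightarrow> 'a set \<Rightarrow> 'a set \<Rightarrow> 'a set"
  where "star_subgroup G A B = generate G {a \<star>\<^bsub>G\<^esub> b | a b. a \<in> A \<and> b \<in> B}"

definition commutator_subgroup :: "('a, 'b) monoid_scheme \<Rightarrow> 'a set \<Rightarrow> 'a set \<Rightarrow> 'a set"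
  where "commutator_subgroup G A B =
    generate G {a \<otimes>\<^bsub>G\<^esub> b \<otimes>\<^bsub>G\<^esub> inv\<^bsub>G\<^esub> a \<otimes>\<^bsub>G\<^esub> inv\<^bsub>G\<^esub> b | a b. a \<in> A \<and> b \<in> B}"

text \<open>The ideal written \<open>\<^sup>M[A,B]\<close> in the literature.\<close>

definition mla_commutator :: "('a, 'b) mla_scheme \<Rightarrow> 'a set \<Rightarrow> 'a set \<Rightarrow> 'a set"
  where "mla_commutator G A B = star_subgroup G A B <#>\<^bsub>G\<^esub> commutator_subgroup G A B"

definition group_center :: "('a, 'b) monoid_scheme \<Rightarrow> 'a set"
  where "group_center G =
    {x \<in> carrier G. \<forall>y\<in>carrier G. x \<otimes>\<^bsub>G\<^esub> y = y \<otimes>\<^bsub>G\<^esub> x}"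

definition lie_center :: "('a, 'b) mla_scheme \<Rightarrow> 'a set"
  where "lie_center G = {x \<in> carrier G. \<forall>y\<in>carrier G. x \<star>\<^bsub>G\<^esub> y = \<one>\<^bsub>G\<^esub>}"

definition mla_center :: "('a, 'b) mla_scheme \<Rightarrow> 'a set"
  where "mla_center G = lie_center G \<inter> group_center G"


section \<open>The free multiplicative Lie algebra on a set\<close>

datatype (gens: 'x) mla_term =
    Gen 'x
  | One
  | Mul "'x mla_term" "'x mla_term"
  | Inv "'x mla_term"
  | Star "'x mla_term" "'x mla_term"

abbreviation Conj :: "'x mla_term \<Rightarrow> 'x mla_term \<Rightarrow> 'x mla_term"
  where "Conj s t \<equiv> Mul (Mul s t) (Inv s)"

definition mla_terms :: "'x set \<Rightarrow> 'x mla_term set"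
  where "mla_terms X = {t. gens t \<subseteq> X}"

inductive_set mla_rel :: "'x set \<Rightarrow> ('x mla_term \<times> 'x mla_term) set" for X :: "'x set"
  where
    refl: "t \<in> mla_terms X \<Longrightarrow> (t, t) \<in> mla_rel X"
  | sym: "(t, u) \<in> mla_rel X \<Longrightarrow> (u, t) \<in> mla_rel X"
  | trans: "\<lbrakk>(t, u) \<in> mla_rel X; (u, v) \<in> mla_rel X\<rbrakk> \<Longrightarrow> (t, v) \<in> mla_rel X"
  | cong_Mul: "\<lbrakk>(t, t') \<in> mla_rel X; (u, u') \<in> mla_rel X\<rbrakk> \<Longrightarrow> (Mul t u, Mul t' u') \<in> mla_rel X"
  | cong_Inv: "(t, t') \<in> mla_rel X \<Longrightarrow> (Inv t, Inv t') \<in> mla_rel X"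
  | cong_Star: "\<lbrakk>(t, t') \<in> mla_rel X; (u, u') \<in> mla_rel X\<rbrakk> \<Longrightarrow> (Star t u, Star t' u') \<in> mla_rel X"
  | assoc: "\<lbrakk>t \<in> mla_terms X; u \<in> mla_terms X; v \<in> mla_terms X\<rbrakk>
      \<Longrightarrow> (Mul (Mul t u) v, Mul t (Mul u v)) \<in> mla_rel X"
  | one_left: "t \<in> mla_terms X \<Longrightarrow> (Mul One t, t) \<in> mla_rel X"
  | inv_left: "t \<in> mla_terms X \<Longrightarrow> (Mul (Inv t) t, One) \<in> mla_rel X"
  | self: "t \<in> mla_terms X \<Longrightarrow> (Star t t, One) \<in> mla_rel X"
  | mult_right: "\<lbrakk>t \<in> mla_terms X; u \<in> mla_terms X; v \<in> mla_terms X\<rbrakk>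
      \<Longrightarrow> (Star t (Mul u v), Mul (Star t u) (Conj u (Star t v))) \<in> mla_rel X"
  | mult_left: "\<lbrakk>t \<in> mla_terms X; u \<in> mla_terms X; v \<in> mla_terms X\<rbrakk>
      \<Longrightarrow> (Star (Mul t u) v, Mul (Conj t (Star u v)) (Star t v)) \<in> mla_rel X"
  | jacobi: "\<lbrakk>t \<in> mla_terms X; u \<in> mla_terms X; v \<in> mla_terms X\<rbrakk>
      \<Longrightarrow> (Mul (Mul (Star (Star t u) (Conj u v)) (Star (Star u v) (Conj v t)))
              (Star (Star v t) (Conj t u)), One) \<in> mla_rel X"
  | conj_star: "\<lbrakk>t \<in> mla_terms X; u \<in> mla_terms X; v \<in> mla_terms X\<rbrakk>
      \<Longrightarrow> (Conj v (Star t u), Star (Conj v t) (Conj v u)) \<in> mla_rel X"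

definition free_mla :: "'x set \<Rightarrow> 'x mla_term set mla"
  where "free_mla X =
    \<lparr>carrier = mla_terms X // mla_rel X,
     mult = (\<lambda>A B. \<Union>a\<in>A. \<Union>b\<in>B. mla_rel X `` {Mul a b}),
     one = mla_rel X `` {One},
     star = (\<lambda>A B. \<Union>a\<in>A. \<Union>b\<in>B. mla_rel X `` {Star a b})\<rparr>"

definition free_gen :: "'x set \<Rightarrow> 'x \<Rightarrow> 'x mla_term set"
  where "free_gen X x = mla_rel X `` {Gen x}"

lemma mla_terms_simps [simp]:
  "Gen x \<in> mla_terms X \<longleftrightarrow> x \<in> X"
  "One \<in> mla_terms X"
  "Mul t u \<in> mla_terms X \<longleftrightarrow> t \<in> mla_terms X \<and> u \<in> mla_terms X"
  "Inv t \<in> mla_terms X \<longleftrightarrow> t \<in> mla_terms X"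
  "Star t u \<in> mla_terms X \<longleftrightarrow> t \<in> mla_terms X \<and> u \<in> mla_terms X"
  by (auto simp: mla_terms_def)

lemma mla_rel_terms: "(t, u) \<in> mla_rel X \<Longrightarrow> t \<in> mla_terms X \<and> u \<in> mla_terms X"
  by (induction rule: mla_rel.induct) auto

lemma equiv_mla_rel: "equiv (mla_terms X) (mla_rel X)"
  by (rule equivI)
    (auto intro!: refl_onI symI transI dest: mla_rel_terms intro: mla_rel.intros)

lemma mla_rel_class_eqI:
  "(t, u) \<in> mla_rel X \<Longrightarrow> mla_rel X `` {t} = mla_rel X `` {u}"
  by (rule equiv_class_eq[OF equiv_mla_rel])

lemma free_mla_class_in:
  "t \<in> mla_terms X \<Longrightarrow> mla_rel X `` {t} \<in> carrier (free_mla X)"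
  by (auto simp: free_mla_def intro: quotientI)

lemma free_mla_carrierE:
  assumes "A \<in> carrier (free_mla X)"
  obtains t where "t \<in> mla_terms X" "A = mla_rel X `` {t}"
  using assms by (auto simp: free_mla_def elim: quotientE)

lemma free_mla_one: "\<one>\<^bsub>free_mla X\<^esub> = mla_rel X `` {One}"
  by (simp add: free_mla_def)

lemma free_mla_mult:
  assumes "t \<in> mla_terms X" "u \<in> mla_terms X"
  shows "mla_rel X `` {t} \<otimes>\<^bsub>free_mla X\<^esub> mla_rel X `` {u} = mla_rel X `` {Mul t u}"
proof -
  have "congruent2 (mla_rel X) (mla_rel X) (\<lambda>a b. mla_rel X `` {Mul a b})"
    by (rule congruent2I') (metis equiv_class_eq equiv_mla_rel mla_rel.cong_Mul)
  from UN_equiv_class2[OF equiv_mla_rel equiv_mla_rel this assms]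
  show ?thesis by (simp add: free_mla_def)
qed

lemma free_mla_star:
  assumes "t \<in> mla_terms X" "u \<in> mla_terms X"
  shows "mla_rel X `` {t} \<star>\<^bsub>free_mla X\<^esub> mla_rel X `` {u} = mla_rel X `` {Star t u}"
proof -
  have "congruent2 (mla_rel X) (mla_rel X) (\<lambda>a b. mla_rel X `` {Star a b})"
    by (rule congruent2I') (metis equiv_class_eq equiv_mla_rel mla_rel.cong_Star)
  from UN_equiv_class2[OF equiv_mla_rel equiv_mla_rel this assms]
  show ?thesis by (simp add: free_mla_def)
qed

lemma group_free_mla: "group (free_mla X)"
proof (rule groupI)
  show "\<one>\<^bsub>free_mla X\<^esub> \<in> carrier (free_mla X)"
    by (simp add: free_mla_one free_mla_class_in)
next
  fix A B assume "A \<in> carrier (free_mla X)" "B \<in> carrier (free_mla X)"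
  then show "A \<otimes>\<^bsub>free_mla X\<^esub> B \<in> carrier (free_mla X)"
    by (auto elim!: free_mla_carrierE simp: free_mla_mult free_mla_class_in)
next
  fix A B C
  assume "A \<in> carrier (free_mla X)" "B \<in> carrier (free_mla X)" "C \<in> carrier (free_mla X)"
  then show "A \<otimes>\<^bsub>free_mla X\<^esub> B \<otimes>\<^bsub>free_mla X\<^esub> C = A \<otimes>\<^bsub>free_mla X\<^esub> (B \<otimes>\<^bsub>free_mla X\<^esub> C)"
    by (auto elim!: free_mla_carrierE simp: free_mla_mult
        del: equalityI intro!: mla_rel_class_eqI mla_rel.assoc)
next
  fix A assume "A \<in> carrier (free_mla X)"
  then show "\<one>\<^bsub>free_mla X\<^esub> \<otimes>\<^bsub>free_mla X\<^esub> A = A"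
    by (auto elim!: free_mla_carrierE
        simp: free_mla_one free_mla_mult del: equalityI intro!: mla_rel_class_eqI mla_rel.one_left)
next
  fix A assume "A \<in> carrier (free_mla X)"
  then obtain t where t: "t \<in> mla_terms X" "A = mla_rel X `` {t}"
    by (rule free_mla_carrierE)
  show "\<exists>B\<in>carrier (free_mla X). B \<otimes>\<^bsub>free_mla X\<^esub> A = \<one>\<^bsub>free_mla X\<^esub>"
    using t by (intro bexI[of _ "mla_rel X `` {Inv t}"])
      (auto simp: free_mla_one free_mla_mult free_mla_class_in
        del: equalityI intro!: mla_rel_class_eqI mla_rel.inv_left)
qed

lemma free_mla_inv:
  assumes "t \<in> mla_terms X"
  shows "inv\<^bsub>free_mla X\<^esub> (mla_rel X `` {t}) = mla_rel X `` {Inv t}"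
  using assms
  by (intro group.inv_equality[OF group_free_mla])
    (auto simp: free_mla_one free_mla_mult free_mla_class_in
      del: equalityI intro!: mla_rel_class_eqI mla_rel.inv_left)

lemma mult_lie_algebra_free_mla: "mult_lie_algebra (free_mla X)"
proof (intro mult_lie_algebra.intro group_free_mla mult_lie_algebra_axioms.intro)
qed (auto elim!: free_mla_carrierE
    simp: conjugate_def free_mla_one free_mla_mult free_mla_star free_mla_inv
      free_mla_class_in
    del: equalityI intro!: mla_rel_class_eqI mla_rel.self mla_rel.mult_right mla_rel.mult_left
      mla_rel.jacobi mla_rel.conj_star)

primrec mla_eval :: "('a, 'b) mla_scheme \<Rightarrow> ('x \<Rightarrow> 'a) \<Rightarrow> 'x mla_term \<Rightarrow> 'a"
  where
    "mla_eval G f (Gen x) = f x"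
  | "mla_eval G f One = \<one>\<^bsub>G\<^esub>"
  | "mla_eval G f (Mul t u) = mla_eval G f t \<otimes>\<^bsub>G\<^esub> mla_eval G f u"
  | "mla_eval G f (Inv t) = inv\<^bsub>G\<^esub> mla_eval G f t"
  | "mla_eval G f (Star t u) = mla_eval G f t \<star>\<^bsub>G\<^esub> mla_eval G f u"

context mult_lie_algebra
begin

lemma mla_eval_closed:
  "\<lbrakk>f ` X \<subseteq> carrier G; t \<in> mla_terms X\<rbrakk> \<Longrightarrow> mla_eval G f t \<in> carrier G"
  by (induction t) auto

lemma mla_eval_rel:
  assumes "f ` X \<subseteq> carrier G" "(t, u) \<in> mla_rel X"
  shows "mla_eval G f t = mla_eval G f u"
  using assms(2)
proof (induction rule: mla_rel.induct)
  case (mult_right t u v)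
  then show ?case
    by (simp add: star_mult_right conjugate_def mla_eval_closed[OF assms(1)])
next
  case (mult_left t u v)
  then show ?case
    by (simp add: star_mult_left conjugate_def mla_eval_closed[OF assms(1)])
next
  case (jacobi t u v)
  then show ?case
    using star_jacobi[of "mla_eval G f t" "mla_eval G f u" "mla_eval G f v"]
    by (simp add: conjugate_def mla_eval_closed[OF assms(1)])
next
  case (conj_star t u v)
  then show ?case
    using conjugate_star[of "mla_eval G f t" "mla_eval G f u" "mla_eval G f v"]
    by (simp add: conjugate_def mla_eval_closed[OF assms(1)])
qed (simp_all add: mla_eval_closed[OF assms(1)] m_assoc star_self)

text \<open>The universal property: \<open>free_mla X\<close> is free on \<open>free_gen X\<close>.\<close>

lemma free_mla_extension:
  assumes "f ` X \<subseteq> carrier G"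
  shows "\<exists>h \<in> mla_hom (free_mla X) G. \<forall>x\<in>X. h (free_gen X x) = f x"
proof -
  define h where "h A = mla_eval G f (SOME t. t \<in> A)" for A
  have h: "h (mla_rel X `` {t}) = mla_eval G f t" if "t \<in> mla_terms X" for t
  proof -
    have "(SOME u. u \<in> mla_rel X `` {t}) \<in> mla_rel X `` {t}"
      using that mla_rel.refl by (intro someI) auto
    then show ?thesis
      unfolding h_def using mla_eval_rel[OF assms] by auto
  qed
  show ?thesis
    by (rule bexI[of _ h])
      (auto simp: mla_hom_def hom_def free_gen_def h free_mla_mult free_mla_star
        mla_eval_closed[OF assms] elim!: free_mla_carrierE)
qed

lemma free_mla_extension_unique:
  assumes h: "h \<in> mla_hom (free_mla X) G" and k: "k \<in> mla_hom (free_mla X) G"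
    and eq: "\<forall>x\<in>X. h (free_gen X x) = k (free_gen X x)"
    and A: "A \<in> carrier (free_mla X)"
  shows "h A = k A"
proof -
  have gh: "group_hom (free_mla X) G h" and gk: "group_hom (free_mla X) G k"
    using h k group_free_mla
    by (auto simp: mla_hom_def group_hom_def group_hom_axioms_def intro: is_group)
  have "t \<in> mla_terms X \<Longrightarrow> h (mla_rel X `` {t}) = k (mla_rel X `` {t})" for t
  proof (induction t)
    case (Gen x)
    then show ?case using eq by (simp add: free_gen_def)
  next
    case One
    then show ?case
      using group_hom.hom_one[OF gh] group_hom.hom_one[OF gk] by (simp add: free_mla_one)
  next
    case (Mul t u)
    then show ?case
      using group_hom.hom_mult[OF gh] group_hom.hom_mult[OF gk]
      by (simp add: free_mla_mult[symmetric] free_mla_class_in)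
  next
    case (Inv t)
    then show ?case
      using group_hom.hom_inv[OF gh] group_hom.hom_inv[OF gk]
      by (simp add: free_mla_inv[symmetric] free_mla_class_in)
  next
    case (Star t u)
    then show ?case
      using h k by (simp add: mla_hom_def free_mla_star[symmetric] free_mla_class_in)
  qed
  then show ?thesis using A by (auto elim: free_mla_carrierE)
qed

end


section \<open>Schur multiplier and covers\<close>

text \<open>A free presentation is given by its epimorphism \<open>\<pi>\<close> from the free algebra on \<open>X\<close>;
  the relation ideal \<open>R\<close> is the kernel of \<open>\<pi>\<close>.\<close>

definition free_presentation ::
    "'x set \<Rightarrow> ('x mla_term set \<Rightarrow> 'a) \<Rightarrow> ('a, 'b) mla_scheme \<Rightarrow> bool"
  where "free_presentation X \<pi> G \<longleftrightarrow>
    \<pi> \<in> mla_hom (free_mla X) G \<and> \<pi> ` carrier (free_mla X) = carrier G"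

definition schur_multiplier ::
    "'x set \<Rightarrow> ('x mla_term set \<Rightarrow> 'a) \<Rightarrow> ('a, 'b) mla_scheme \<Rightarrow> 'x mla_term set set mla"
  where "schur_multiplier X \<pi> G =
    (let F = free_mla X; R = kernel F G \<pi>
     in F\<lparr>carrier := mla_commutator F (carrier F) (carrier F) \<inter> R\<rparr>
          Mod\<^sub>M mla_commutator F R (carrier F))"

lemma (in mult_lie_algebra) ex_free_presentation:
  "\<exists>\<pi>. free_presentation (carrier G) \<pi> G"
proof -
  obtain h where h: "h \<in> mla_hom (free_mla (carrier G)) G"
      and "\<forall>x\<in>carrier G. h (free_gen (carrier G) x) = x"
    using free_mla_extension[of "\<lambda>x. x" "carrier G"] by auto
  then have "carrier G \<subseteq> h ` carrier (free_mla (carrier G))"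
    by (metis (no_types, lifting) free_gen_def free_mla_class_in image_eqI
        mla_terms_simps(1) subsetI)
  with h show ?thesis
    unfolding free_presentation_def mla_hom_def hom_def by blast
qed

text \<open>A central extension \<open>1 \<rightarrow> N \<rightarrow> E \<rightarrow> G \<rightarrow> 1\<close>, with \<open>N\<close> a subset of \<open>E\<close> and \<open>p\<close> the
  epimorphism onto \<open>G\<close>.\<close>

definition central_extension ::
    "'e set \<Rightarrow> ('e, 'c) mla_scheme \<Rightarrow> ('e \<Rightarrow> 'a) \<Rightarrow> ('a, 'b) mla_scheme \<Rightarrow> bool"
  where "central_extension N E p G \<longleftrightarrow>
    mult_lie_algebra E \<and> mult_lie_algebra G \<and>
    p \<in> mla_hom E G \<and> p ` carrier E = carrier G \<and> N = kernel E G p \<and>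
    N \<subseteq> mla_center E"

definition stem_extension ::
    "'e set \<Rightarrow> ('e, 'c) mla_scheme \<Rightarrow> ('e \<Rightarrow> 'a) \<Rightarrow> ('a, 'b) mla_scheme \<Rightarrow> bool"
  where "stem_extension N E p G \<longleftrightarrow>
    central_extension N E p G \<and> N \<subseteq> mla_commutator E (carrier E) (carrier E)"

text \<open>The Schur multiplier is determined up to isomorphism, so \<open>N\<close> is required to be
  isomorphic to the one computed from each free presentation.  The generators range over
  subsets of the carrier type of \<open>G\<close>; by \<open>ex_free_presentation\<close> such presentations exist.\<close>

definition stem_cover ::
    "'e set \<Rightarrow> ('e, 'c) mla_scheme \<Rightarrow> ('e \<Rightarrow> 'a) \<Rightarrow> ('a, 'b) mla_scheme \<Rightarrow> bool"
  where "stem_cover N E p G \<longleftrightarrow>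
    stem_extension N E p G \<and>
    (\<forall>(X :: 'a set) \<pi>. free_presentation X \<pi> G \<longrightarrow>
       E\<lparr>carrier := N\<rparr> \<cong>\<^sub>M schur_multiplier X \<pi> G)"

definition is_cover :: "('e, 'c) mla_scheme \<Rightarrow> ('a, 'b) mla_scheme \<Rightarrow> bool"
  where "is_cover E G \<longleftrightarrow> (\<exists>N p. stem_cover N E p G)"

end

theory Submission
  imports Defs "HOL-Algebra.SndIsomorphismGrp" "HOL-Algebra.FiniteProduct"
begin

text \<open>Let \<open>1 \<rightarrow> R \<rightarrow> F \<rightarrow> G \<rightarrow> 1\<close> be the free presentation on the elements of \<open>G\<close>.  The
  abelianization \<open>F/\<^sup>M[F,F]\<close> is free abelian of finite rank, so its subgroup
  \<open>R/(\<^sup>M[F,F] \<inter> R)\<close> is free and \<open>R/\<^sup>M[R,F]\<close> splits as the multiplier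
  \<open>(\<^sup>M[F,F] \<inter> R)/\<^sup>M[R,F]\<close> times some \<open>S/\<^sup>M[R,F]\<close>.  Then \<open>F/S\<close> is a cover, with kernel \<open>R/S\<close>.
  The multiplier does not depend on the presentation because two homomorphisms that differ by
  central factors agree on \<open>\<^sup>M[F,F]\<close>.\<close>

section \<open>Ideals, quotients and homomorphisms\<close>

text \<open>The conditions on S come from the two halves of the definition of a cover. The stem
  condition for R/S amounts to \<open>R = S (R \<inter> \<^sup>M[F,F])\<close>; for R/S to carry the
  whole multiplier, S must meet \<open>\<^sup>M[F,F]\<close> only in \<open>\<^sup>M[R,F]\<close>.
  Every subgroup between \<open>\<^sup>M[R,F]\<close> and R is an ideal, so S only has to be found
  as a subgroup. The splitting is obtained without choosing a basis of a free abelian group. The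
  abelianization is seen through one homomorphism to the integers per generator, and S grows by one
  cyclic piece per homomorphism, because subgroups of the integers are cyclic. Finiteness of G makes
  this induction finite. A cover must match the multiplier of every presentation, including those
  with infinitely many generators; these are reached by comparison with the finite one and not by
  building S anew.\<close>

lemma (in group) mult_inv_cancel:
  "\<lbrakk>x \<in> carrier G; y \<in> carrier G\<rbrakk> \<Longrightarrow> x \<otimes> (inv x \<otimes> y) = y"
  "\<lbrakk>x \<in> carrier G; y \<in> carrier G\<rbrakk> \<Longrightarrow> inv x \<otimes> (x \<otimes> y) = y"
  by (simp_all flip: m_assoc)

context mult_lie_algebra
begin

lemma conjugate_closed [simp]:
  "\<lbrakk>x \<in> carrier G; y \<in> carrier G\<rbrakk> \<Longrightarrow> x \<triangleright> y \<in> carrier G"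
  by (simp add: conjugate_def)

lemma conjugate_mult:
  "\<lbrakk>x \<in> carrier G; y \<in> carrier G; z \<in> carrier G\<rbrakk> \<Longrightarrow> x \<triangleright> (y \<otimes> z) = (x \<triangleright> y) \<otimes> (x \<triangleright> z)"
  by (simp add: conjugate_def m_assoc mult_inv_cancel)

lemma conjugate_one [simp]: "x \<in> carrier G \<Longrightarrow> x \<triangleright> \<one> = \<one>"
  by (simp add: conjugate_def)

lemma conjugate_eq_oneD:
  assumes "x \<in> carrier G" "y \<in> carrier G" "x \<triangleright> y = \<one>"
  shows "y = \<one>"
proof -
  have "y = inv x \<otimes> ((x \<triangleright> y) \<otimes> x)"
    using assms(1,2) by (simp add: conjugate_def m_assoc mult_inv_cancel)
  then show ?thesis
    using assms by simp
qed

text \<open>Expanding \<open>(x \<otimes> y) \<star> (x \<otimes> y) = \<one>\<close> by both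
  product rules leaves the conjugate by \<open>x\<close> of
  \<open>(y \<star> x) \<otimes> (x \<star> y)\<close>. This is what makes one-sided conditions on
  \<open>\<star>\<close> two-sided.\<close>

lemma star_commute_inv:
  assumes "x \<in> carrier G" "y \<in> carrier G"
  shows "y \<star> x = inv (x \<star> y)"
proof -
  have "(x \<otimes> y) \<star> (x \<otimes> y) = (x \<triangleright> (y \<star> (x \<otimes> y))) \<otimes> (x \<star> (x \<otimes> y))"
    using assms by (intro star_mult_left) simp_all
  moreover have "y \<star> (x \<otimes> y) = y \<star> x" "x \<star> (x \<otimes> y) = x \<triangleright> (x \<star> y)"
    using assms by (simp_all add: star_mult_right star_self)
  ultimately have "x \<triangleright> ((y \<star> x) \<otimes> (x \<star> y)) = (x \<otimes> y) \<star> (x \<otimes> y)"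
    using assms by (simp only: conjugate_mult star_closed)
  then have "x \<triangleright> ((y \<star> x) \<otimes> (x \<star> y)) = \<one>"
    using assms by (simp add: star_self)
  then have "(y \<star> x) \<otimes> (x \<star> y) = \<one>"
    using assms conjugate_eq_oneD[of x "(y \<star> x) \<otimes> (x \<star> y)"] by simp
  then show ?thesis
    using assms by (simp add: inv_equality)
qed

lemma subalgebra_is_mla:
  assumes "subgroup H G" and "\<And>x y. \<lbrakk>x \<in> H; y \<in> H\<rbrakk> \<Longrightarrow> x \<star> y \<in> H"
  shows "mult_lie_algebra (G\<lparr>carrier := H\<rparr>)"
proof -
  have H: "x \<in> carrier G" if "x \<in> H" for x
    using that assms(1) by (rule subgroup.mem_carrier[rotated])
  interpret H: group "G\<lparr>carrier := H\<rparr>"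
    using assms(1) by (rule subgroup_imp_group)
  show ?thesis
  proof
    fix x y z
    assume "x \<in> carrier (G\<lparr>carrier := H\<rparr>)" "y \<in> carrier (G\<lparr>carrier := H\<rparr>)"
      "z \<in> carrier (G\<lparr>carrier := H\<rparr>)"
    then have xyz: "x \<in> H" "y \<in> H" "z \<in> H"
      by simp_all
    have conj: "u \<triangleright>\<^bsub>G\<lparr>carrier := H\<rparr>\<^esub> v = u \<triangleright> v" if "u \<in> H" for u v
      using that assms(1) by (simp add: conjugate_def)
    show "x \<star>\<^bsub>G\<lparr>carrier := H\<rparr>\<^esub> (y \<otimes>\<^bsub>G\<lparr>carrier := H\<rparr>\<^esub> z) = (x \<star>\<^bsub>G\<lparr>carrier := H\<rparr>\<^esub> y)
        \<otimes>\<^bsub>G\<lparr>carrier := H\<rparr>\<^esub> (y \<triangleright>\<^bsub>G\<lparr>carrier := H\<rparr>\<^esub> (x \<star>\<^bsub>G\<lparr>carrier := H\<rparr>\<^esub> z))"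
      using xyz H by (simp add: conj star_mult_right)
    show "(x \<otimes>\<^bsub>G\<lparr>carrier := H\<rparr>\<^esub> y) \<star>\<^bsub>G\<lparr>carrier := H\<rparr>\<^esub> z =
        (x \<triangleright>\<^bsub>G\<lparr>carrier := H\<rparr>\<^esub> (y \<star>\<^bsub>G\<lparr>carrier := H\<rparr>\<^esub> z)) \<otimes>\<^bsub>G\<lparr>carrier := H\<rparr>\<^esub> (x \<star>\<^bsub>G\<lparr>carrier := H\<rparr>\<^esub> z)"
      using xyz H by (simp add: conj star_mult_left)
    show "((x \<star>\<^bsub>G\<lparr>carrier := H\<rparr>\<^esub> y) \<star>\<^bsub>G\<lparr>carrier := H\<rparr>\<^esub> (y \<triangleright>\<^bsub>G\<lparr>carrier := H\<rparr>\<^esub> z)) \<otimes>\<^bsub>G\<lparr>carrier := H\<rparr>\<^esub>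
        ((y \<star>\<^bsub>G\<lparr>carrier := H\<rparr>\<^esub> z) \<star>\<^bsub>G\<lparr>carrier := H\<rparr>\<^esub> (z \<triangleright>\<^bsub>G\<lparr>carrier := H\<rparr>\<^esub> x)) \<otimes>\<^bsub>G\<lparr>carrier := H\<rparr>\<^esub>
        ((z \<star>\<^bsub>G\<lparr>carrier := H\<rparr>\<^esub> x) \<star>\<^bsub>G\<lparr>carrier := H\<rparr>\<^esub> (x \<triangleright>\<^bsub>G\<lparr>carrier := H\<rparr>\<^esub> y)) =
        \<one>\<^bsub>G\<lparr>carrier := H\<rparr>\<^esub>"
      using xyz H by (simp add: conj star_jacobi)
    show "z \<triangleright>\<^bsub>G\<lparr>carrier := H\<rparr>\<^esub> (x \<star>\<^bsub>G\<lparr>carrier := H\<rparr>\<^esub> y) =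
        (z \<triangleright>\<^bsub>G\<lparr>carrier := H\<rparr>\<^esub> x) \<star>\<^bsub>G\<lparr>carrier := H\<rparr>\<^esub> (z \<triangleright>\<^bsub>G\<lparr>carrier := H\<rparr>\<^esub> y)"
      using xyz H by (simp add: conj conjugate_star)
  qed (use assms H in \<open>simp_all add: star_self\<close>)
qed

lemma mla_hom_group_hom:
  assumes "h \<in> mla_hom G H" "group H"
  shows "group_hom G H h"
  using assms by (simp add: mla_hom_def group_hom_def group_hom_axioms_def is_group)

end

lemma mla_homI:
  assumes "h \<in> hom G H"
    and "\<And>x y. \<lbrakk>x \<in> carrier G; y \<in> carrier G\<rbrakk> \<Longrightarrow> h (x \<star>\<^bsub>G\<^esub> y) = h x \<star>\<^bsub>H\<^esub> h y"
  shows "h \<in> mla_hom G H"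
  using assms by (simp add: mla_hom_def)

lemma mla_hom_mult:
  "\<lbrakk>h \<in> mla_hom G H; x \<in> carrier G; y \<in> carrier G\<rbrakk> \<Longrightarrow> h (x \<otimes>\<^bsub>G\<^esub> y) = h x \<otimes>\<^bsub>H\<^esub> h y"
  by (simp add: mla_hom_def hom_def)

lemma mla_hom_star:
  "\<lbrakk>h \<in> mla_hom G H; x \<in> carrier G; y \<in> carrier G\<rbrakk> \<Longrightarrow> h (x \<star>\<^bsub>G\<^esub> y) = h x \<star>\<^bsub>H\<^esub> h y"
  by (simp add: mla_hom_def)

lemma mla_hom_closed: "\<lbrakk>h \<in> mla_hom G H; x \<in> carrier G\<rbrakk> \<Longrightarrow> h x \<in> carrier H"
  by (auto simp: mla_hom_def hom_def)

lemma mla_hom_compose: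
  "\<lbrakk>h \<in> mla_hom G H; k \<in> mla_hom H K\<rbrakk> \<Longrightarrow> k \<circ> h \<in> mla_hom G K"
  by (simp add: mla_hom_def hom_def Pi_iff)

text \<open>\<open>first_isomorphism\<close> yields a map out of a quotient, whereas
  \<open>stem_cover\<close> asks for a map into one; the inverse map links the two.\<close>

lemma mla_is_iso_sym:
  fixes G (structure)
  assumes "mult_lie_algebra G" "G \<cong>\<^sub>M H"
  shows "H \<cong>\<^sub>M G"
proof -
  interpret mult_lie_algebra G by fact
  obtain h where h: "h \<in> mla_hom G H" "bij_betw h (carrier G) (carrier H)"
    using assms(2) by (auto simp: mla_is_iso_def)
  let ?k = "inv_into (carrier G) h"
  have k: "?k x \<in> carrier G" "h (?k x) = x" if "x \<in> carrier H" for x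
    using h(2) that by (auto simp: bij_betw_def inv_into_into f_inv_into_f)
  have hk: "?k (h x) = x" if "x \<in> carrier G" for x
    using h(2) that by (simp add: bij_betw_def)
  have "?k (x \<otimes>\<^bsub>H\<^esub> y) = ?k x \<otimes> ?k y" if "x \<in> carrier H" "y \<in> carrier H" for x y
    using that k hk[of "?k x \<otimes> ?k y"] by (simp add: mla_hom_mult[OF h(1)])
  moreover have "?k (x \<star>\<^bsub>H\<^esub> y) = ?k x \<star> ?k y" if "x \<in> carrier H" "y \<in> carrier H" for x y
    using that k hk[of "?k x \<star> ?k y"] by (simp add: mla_hom_star[OF h(1)])
  ultimately have "?k \<in> mla_hom H G"
    using k by (auto simp: mla_hom_def hom_def)
  then show ?thesis
    using bij_betw_inv_into[OF h(2)] by (auto simp: mla_is_iso_def)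
qed

section \<open>Ideals and factor algebras\<close>

locale mla_ideal = normal H G + mult_lie_algebra G for H and G (structure) +
  assumes star_ideal: "\<lbrakk>x \<in> carrier G; y \<in> H\<rbrakk> \<Longrightarrow> x \<star> y \<in> H"
begin

lemma star_ideal_left: "\<lbrakk>x \<in> H; y \<in> carrier G\<rbrakk> \<Longrightarrow> x \<star> y \<in> H"
  using star_ideal[of y x] star_commute_inv[of y x] by auto

lemma coset_eq_iff:
  assumes "x \<in> carrier G" "y \<in> carrier G"
  shows "H #> x = H #> y \<longleftrightarrow> x \<otimes> inv y \<in> H"
  using assms rcos_module[OF is_group, of y x] rcos_self[OF assms(1) subgroup_axioms]
    repr_independence[OF _ assms(2) subgroup_axioms, of x] by auto

text \<open>The product rules split off a factor that lies in \<open>H\<close> and conjugate the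
  other factor by an element of \<open>H\<close>; neither changes the coset. Hence the union that
  defines \<open>\<star>\<close> on the factor structure is a single coset.\<close>

lemma coset_star_coset:
  assumes "h \<in> H" "k \<in> H" "x \<in> carrier G" "y \<in> carrier G"
  shows "H #> ((h \<otimes> x) \<star> (k \<otimes> y)) = H #> (x \<star> y)"
proof -
  have H: "h \<in> carrier G" "k \<in> carrier G"
    using assms by auto
  have c: "H #> (z \<triangleright> w) = H #> w" if "z \<in> H" "w \<in> carrier G" for z w
  proof -
    have z: "z \<in> carrier G" using that by simp
    have "z \<triangleright> w \<otimes> inv w = z \<otimes> (w \<otimes> inv z \<otimes> inv w)"
      using that z by (simp add: conjugate_def m_assoc)
    also have "\<dots> \<in> H"
      using that by (simp add: inv_op_closed2)
    finally show ?thesis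
      using that z by (simp add: coset_eq_iff)
  qed
  have d: "H #> (u \<otimes> v) = H #> v" if "u \<in> H" "v \<in> carrier G" for u v
    using that by (simp add: coset_eq_iff m_assoc)
  have e: "H #> (u \<otimes> v) = H #> u" if "v \<in> H" "u \<in> carrier G" for u v
    using that by (simp add: coset_eq_iff inv_op_closed2)
  have "H #> ((h \<otimes> x) \<star> (k \<otimes> y)) = H #> (x \<star> (k \<otimes> y))"
    using assms H by (simp add: star_mult_left e c star_ideal_left)
  also have "\<dots> = H #> (x \<star> y)"
    using assms H by (simp add: star_mult_right d c star_ideal)
  finally show ?thesis .
qed

lemma quotient_mult:
  "\<lbrakk>x \<in> carrier G; y \<in> carrier G\<rbrakk> \<Longrightarrow> (H #> x) \<otimes>\<^bsub>G Mod\<^sub>M H\<^esub> (H #> y) = H #> (x \<otimes> y)"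
  by (simp add: mla_quotient_def rcos_sum)

lemma quotient_star:
  assumes "x \<in> carrier G" "y \<in> carrier G"
  shows "(H #> x) \<star>\<^bsub>G Mod\<^sub>M H\<^esub> (H #> y) = H #> (x \<star> y)"
proof -
  have "H #> (a \<star> b) = H #> (x \<star> y)" if "a \<in> H #> x" "b \<in> H #> y" for a b
    using that assms by (auto simp: r_coset_def[of G H x] r_coset_def[of G H y] coset_star_coset)
  then have "(\<Union>a\<in>H #> x. \<Union>b\<in>H #> y. H #> (a \<star> b)) = H #> (x \<star> y)"
    using assms rcos_self[OF _ subgroup_axioms] by blast
  then show ?thesis
    by (simp add: mla_quotient_def)
qed

lemma quotient_carrier: "carrier (G Mod\<^sub>M H) = (\<lambda>x. H #> x) ` carrier G"
  by (auto simp: mla_quotient_def RCOSETS_def)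

lemma quotient_one: "\<one>\<^bsub>G Mod\<^sub>M H\<^esub> = H"
  by (simp add: mla_quotient_def)

lemma coset_eq_one_iff: "x \<in> carrier G \<Longrightarrow> H #> x = \<one>\<^bsub>G Mod\<^sub>M H\<^esub> \<longleftrightarrow> x \<in> H"
  using coset_join1[of H x] coset_join2[of x H] subgroup_axioms by (auto simp: quotient_one)

lemma group_quotient: "group (G Mod\<^sub>M H)"
proof -
  interpret Q: group "G Mod H" by (rule factorgroup_is_group)
  have "carrier (G Mod\<^sub>M H) = carrier (G Mod H)" "mult (G Mod\<^sub>M H) = mult (G Mod H)"
      "one (G Mod\<^sub>M H) = one (G Mod H)"
    by (simp_all add: FactGroup_def mla_quotient_def)
  then show ?thesis
    by (intro groupI) (use Q.l_inv_ex in
        \<open>simp_all add: Q.m_assoc del: mult_FactGroup one_FactGroup\<close>)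
qed

lemma quotient_hom: "(\<lambda>x. H #> x) \<in> mla_hom G (G Mod\<^sub>M H)"
  by (auto simp: mla_hom_def hom_def quotient_carrier quotient_mult quotient_star)

lemma quotient_inv:
  "x \<in> carrier G \<Longrightarrow> inv\<^bsub>G Mod\<^sub>M H\<^esub> (H #> x) = H #> inv x"
  using group_hom.hom_inv[OF mla_hom_group_hom[OF quotient_hom group_quotient]] by simp

lemma quotient_is_mla: "mult_lie_algebra (G Mod\<^sub>M H)"
proof -
  interpret Q: group "G Mod\<^sub>M H" by (rule group_quotient)
  have conj: "(H #> x) \<triangleright>\<^bsub>G Mod\<^sub>M H\<^esub> (H #> y) = H #> (x \<triangleright> y)"
    if "x \<in> carrier G" "y \<in> carrier G" for x y
    using that by (simp add: conjugate_def quotient_mult quotient_inv)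
  show ?thesis
    by unfold_locales
      (auto simp: quotient_carrier quotient_mult quotient_star conj quotient_one subset star_self
        star_mult_right star_mult_left star_jacobi simp flip: conjugate_star)
qed

lemma quotient_factor:
  assumes h: "h \<in> mla_hom G K" and K: "group K" and ker: "H \<subseteq> kernel G K h"
  shows "\<exists>k \<in> mla_hom (G Mod\<^sub>M H) K. \<forall>x\<in>carrier G. k (H #> x) = h x"
proof -
  interpret h: group_hom G K h
    using h K by (rule mla_hom_group_hom)
  obtain k where k: "k \<in> hom (G Mod H) K" "\<And>x. x \<in> carrier G \<Longrightarrow> k (H #> x) = h x"
    using h.FactGroup_universal_kernel[OF normal_axioms ker] by metis
  have "k \<in> mla_hom (G Mod\<^sub>M H) K"
  proof (rule mla_homI)
    show "k \<in> hom (G Mod\<^sub>M H) K"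
      using k(1) by (simp add: hom_def FactGroup_def mla_quotient_def)
  qed (auto simp: quotient_carrier quotient_star k(2) mla_hom_star[OF h])
  with k(2) show ?thesis
    by blast
qed

end

lemma (in mult_lie_algebra) star_one:
  assumes "x \<in> carrier G"
  shows "x \<star> \<one> = \<one>"
proof -
  have "(x \<star> \<one>) \<otimes> (x \<star> \<one>) = (x \<star> \<one>) \<otimes> \<one>"
    using star_mult_right[of x \<one> \<one>, symmetric] assms by (simp add: conjugate_def)
  then show ?thesis
    using assms by (simp del: r_one)
qed

lemma (in mult_lie_algebra) kernel_ideal:
  assumes h: "h \<in> mla_hom G H" and H: "mult_lie_algebra H"
  shows "mla_ideal (kernel G H h) G"
proof -
  interpret H: mult_lie_algebra H by fact
  interpret h: group_hom G H h
    using h H.is_group by (rule mla_hom_group_hom)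
  show ?thesis
    by (intro mla_ideal.intro h.normal_kernel mult_lie_algebra_axioms mla_ideal_axioms.intro)
      (auto simp: kernel_def mla_hom_star[OF h] H.star_one)
qed

lemma (in mult_lie_algebra) first_isomorphism:
  assumes h: "h \<in> mla_hom G H" and H: "mult_lie_algebra H" and surj: "h ` carrier G = carrier H"
  shows "G Mod\<^sub>M kernel G H h \<cong>\<^sub>M H"
proof -
  interpret H: mult_lie_algebra H by fact
  interpret h: group_hom G H h
    using h H.is_group by (rule mla_hom_group_hom)
  have ker: "x \<otimes> inv y \<in> kernel G H h" if "x \<in> carrier G" "y \<in> carrier G" "h x = h y" for x y
    using that by (simp add: kernel_def)
  interpret K: mla_ideal "kernel G H h" G
    using h H by (rule kernel_ideal)
  obtain k where k: "k \<in> mla_hom (G Mod\<^sub>M kernel G H h) H"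
      "\<And>x. x \<in> carrier G \<Longrightarrow> k (kernel G H h #> x) = h x"
    using K.quotient_factor[OF h H.is_group order.refl] by blast
  have "inj_on k (carrier (G Mod\<^sub>M kernel G H h))"
  proof (rule inj_onI)
    fix u v
    assume "u \<in> carrier (G Mod\<^sub>M kernel G H h)" "v \<in> carrier (G Mod\<^sub>M kernel G H h)" "k u = k v"
    then obtain x y where xy: "x \<in> carrier G" "y \<in> carrier G"
        "u = kernel G H h #> x" "v = kernel G H h #> y" and "k u = k v"
      unfolding K.quotient_carrier by blast
    then have "h x = h y"
      by (simp only: k(2))
    then show "u = v"
      using xy ker[of x y] K.coset_eq_iff[of x y] by simp
  qed
  moreover have "k ` carrier (G Mod\<^sub>M kernel G H h) = carrier H"
    by (simp add: K.quotient_carrier image_image k(2) surj)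
  ultimately show ?thesis
    using k(1) by (auto simp: mla_is_iso_def bij_betw_def)
qed

section \<open>The ideal \<open>\<^sup>M[A,G]\<close>\<close>

context mult_lie_algebra
begin

lemma carrier_ideal: "mla_ideal (carrier G) G"
  by (intro mla_ideal.intro normal_self mult_lie_algebra_axioms mla_ideal_axioms.intro) simp

lemma conjugate_commutator:
  assumes "g \<in> carrier G" "a \<in> carrier G" "b \<in> carrier G"
  shows "g \<otimes> (a \<otimes> b \<otimes> inv a \<otimes> inv b) \<otimes> inv g =
    (g \<triangleright> a) \<otimes> (g \<triangleright> b) \<otimes> inv (g \<triangleright> a) \<otimes> inv (g \<triangleright> b)"
  using assms by (simp add: conjugate_def inv_mult_group m_assoc mult_inv_cancel)

text \<open>Conjugation is an automorphism of both operations and preserves \<open>A\<close>, so it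
  permutes each of the two generating sets. Both generated subgroups are therefore normal, and so is
  their product.\<close>

lemma mla_commutator_normal:
  assumes "mla_ideal A G"
  shows "mla_commutator G A (carrier G) \<lhd> G"
proof -
  interpret A: mla_ideal A G by fact
  have conj: "g \<triangleright> a \<in> A" if "g \<in> carrier G" "a \<in> A" for g a
    using that by (simp add: conjugate_def A.inv_op_closed2)
  have "star_subgroup G A (carrier G) \<lhd> G"
    unfolding star_subgroup_def
  proof (rule normal_generateI)
    fix h g
    assume g: "g \<in> carrier G" and "h \<in> {a \<star> b |a b. a \<in> A \<and> b \<in> carrier G}"
    then obtain a b where h: "h = a \<star> b" "a \<in> A" "b \<in> carrier G" by blast
    have "g \<otimes> h \<otimes> inv g = (g \<triangleright> a) \<star> (g \<triangleright> b)"
      using g h conjugate_star[of a b g] by (simp add: conjugate_def)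
    then show "g \<otimes> h \<otimes> inv g \<in> {a \<star> b |a b. a \<in> A \<and> b \<in> carrier G}"
      using g h conj by (blast intro: conjugate_closed)
  qed auto
  moreover have "commutator_subgroup G A (carrier G) \<lhd> G"
    unfolding commutator_subgroup_def
  proof (rule normal_generateI)
    fix h g
    assume g: "g \<in> carrier G"
      and "h \<in> {a \<otimes> b \<otimes> inv a \<otimes> inv b |a b. a \<in> A \<and> b \<in> carrier G}"
    then obtain a b where h: "h = a \<otimes> b \<otimes> inv a \<otimes> inv b" "a \<in> A" "b \<in> carrier G" by blast
    then have "g \<otimes> h \<otimes> inv g = (g \<triangleright> a) \<otimes> (g \<triangleright> b) \<otimes> inv (g \<triangleright> a) \<otimes> inv (g \<triangleright> b)"
      using g by (simp only: conjugate_commutator A.mem_carrier)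
    then show "g \<otimes> h \<otimes> inv g \<in> {a \<otimes> b \<otimes> inv a \<otimes> inv b |a b. a \<in> A \<and> b \<in> carrier G}"
      using g h conj by (blast intro: conjugate_closed)
  qed auto
  ultimately show ?thesis
    unfolding mla_commutator_def by (rule normal_subgroup_set_mult_closed)
qed

lemma mla_commutator_subgroup:
  "mla_ideal A G \<Longrightarrow> subgroup (mla_commutator G A (carrier G)) G"
  by (rule normal_imp_subgroup) (rule mla_commutator_normal)

lemma mla_commutator_star:
  assumes "A \<subseteq> carrier G" "B \<subseteq> carrier G" "a \<in> A" "b \<in> B"
  shows "a \<star> b \<in> mla_commutator G A B"
proof -
  have "a \<star> b \<in> star_subgroup G A B"
    unfolding star_subgroup_def using assms by (blast intro: generate.incl)
  moreover have "\<one> \<in> commutator_subgroup G A B"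
    unfolding commutator_subgroup_def by (rule generate.one)
  moreover have "a \<star> b = (a \<star> b) \<otimes> \<one>"
    using assms by (simp add: subset_iff)
  ultimately show ?thesis
    unfolding mla_commutator_def set_mult_def by blast
qed

lemma mla_commutator_commutator:
  assumes "A \<subseteq> carrier G" "B \<subseteq> carrier G" "a \<in> A" "b \<in> B"
  shows "a \<otimes> b \<otimes> inv a \<otimes> inv b \<in> mla_commutator G A B"
proof -
  have "a \<otimes> b \<otimes> inv a \<otimes> inv b \<in> commutator_subgroup G A B"
    unfolding commutator_subgroup_def using assms by (blast intro: generate.incl)
  moreover have "\<one> \<in> star_subgroup G A B"
    unfolding star_subgroup_def by (rule generate.one)
  moreover have "a \<otimes> b \<otimes> inv a \<otimes> inv b = \<one> \<otimes> (a \<otimes> b \<otimes> inv a \<otimes> inv b)"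
    using assms by (simp add: subset_iff)
  ultimately show ?thesis
    unfolding mla_commutator_def set_mult_def by blast
qed

text \<open>This acts as the induction principle for \<open>mla_commutator\<close>: a property that
  defines a subgroup is checked on the two kinds of generators only.\<close>

lemma mla_commutator_least:
  assumes S: "subgroup S G"
    and star: "\<And>a b. \<lbrakk>a \<in> A; b \<in> B\<rbrakk> \<Longrightarrow> a \<star> b \<in> S"
    and comm: "\<And>a b. \<lbrakk>a \<in> A; b \<in> B\<rbrakk> \<Longrightarrow> a \<otimes> b \<otimes> inv a \<otimes> inv b \<in> S"
  shows "mla_commutator G A B \<subseteq> S"
proof -
  have "star_subgroup G A B \<subseteq> S"
    unfolding star_subgroup_def by (rule generate_subgroup_incl[OF _ S]) (use star in blast)
  moreover have "commutator_subgroup G A B \<subseteq> S"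
    unfolding commutator_subgroup_def by (rule generate_subgroup_incl[OF _ S]) (use comm in blast)
  ultimately show ?thesis
    unfolding mla_commutator_def set_mult_def using subgroup.m_closed[OF S] by blast
qed

lemma mla_commutator_subset_ideal:
  assumes "mla_ideal A G"
  shows "mla_commutator G A (carrier G) \<subseteq> A"
proof -
  interpret A: mla_ideal A G by fact
  show ?thesis
  proof (rule mla_commutator_least)
    fix a b assume "a \<in> A" "b \<in> carrier G"
    then have "a \<otimes> (b \<otimes> inv a \<otimes> inv b) \<in> A"
      by (intro A.m_closed A.inv_op_closed2) auto
    then show "a \<otimes> b \<otimes> inv a \<otimes> inv b \<in> A"
      using \<open>a \<in> A\<close> \<open>b \<in> carrier G\<close> by (simp add: m_assoc)
  qed (simp_all add: A.subgroup_axioms A.star_ideal_left)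
qed

lemma mla_commutator_mono:
  assumes "A \<subseteq> carrier G"
  shows "mla_commutator G A (carrier G) \<subseteq> mla_commutator G (carrier G) (carrier G)"
  using assms mla_commutator_subgroup[OF carrier_ideal]
  by (intro mla_commutator_least mla_commutator_star mla_commutator_commutator) auto

text \<open>Conjugating \<open>s\<close> by \<open>g\<close> multiplies it by the inverse of the
  commutator of \<open>s\<close> and \<open>g\<close>, and \<open>x \<star> s\<close> is the inverse
  of \<open>s \<star> x\<close>; both corrections lie in the lower bound. A complement constructed
  by pure group theory thus becomes an ideal.\<close>

lemma ideal_between:
  assumes A: "mla_ideal A G" and S: "subgroup S G"
    and le: "mla_commutator G A (carrier G) \<subseteq> S" "S \<subseteq> A"
  shows "mla_ideal S G"
proof -
  interpret A: mla_ideal A G by fact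
  interpret S: subgroup S G by fact
  have "S \<lhd> G"
  proof (rule normal_invI[OF S])
    fix g s assume g: "g \<in> carrier G" and s: "s \<in> S"
    have "inv (s \<otimes> g \<otimes> inv s \<otimes> inv g) \<in> S"
      using g s le mla_commutator_commutator[of A "carrier G" s g] A.subset by (blast intro: S.m_inv_closed)
    then have "inv (s \<otimes> g \<otimes> inv s \<otimes> inv g) \<otimes> s \<in> S"
      using s by simp
    then show "g \<otimes> s \<otimes> inv g \<in> S"
      using g s by (simp add: inv_mult_group m_assoc)
  qed
  moreover have "x \<star> s \<in> S" if "x \<in> carrier G" "s \<in> S" for x s
  proof -
    have "s \<star> x \<in> S"
      using that le mla_commutator_star[of A "carrier G" s x] A.subset by blast
    then show ?thesis
      using that star_commute_inv[of s x] by simp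
  qed
  ultimately show ?thesis
    by (intro mla_ideal.intro mult_lie_algebra_axioms mla_ideal_axioms.intro)
qed

text \<open>Dividing by \<open>S\<close> kills \<open>r \<star> y\<close> and the commutator of
  \<open>r\<close> and \<open>y\<close>, which are the two obstructions to centrality. It makes the
  final extension central and supplies the central factors when presentations are compared.\<close>

lemma coset_in_center:
  assumes A: "mla_ideal A G" and S: "mla_ideal S G"
    and le: "mla_commutator G A (carrier G) \<subseteq> S" and r: "r \<in> A"
  shows "S #> r \<in> mla_center (G Mod\<^sub>M S)"
proof -
  interpret A: mla_ideal A G by fact
  interpret S: mla_ideal S G by fact
  have "r \<star> y \<in> S" "r \<otimes> y \<otimes> inv r \<otimes> inv y \<in> S" if "y \<in> carrier G" for y
    using that r le mla_commutator_star[of A "carrier G" r y]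
      mla_commutator_commutator[of A "carrier G" r y] A.subset by auto
  then show ?thesis
    using r by (auto simp: mla_center_def lie_center_def group_center_def S.quotient_carrier
      S.quotient_star S.quotient_mult S.coset_eq_iff S.coset_eq_one_iff inv_mult_group m_assoc)
qed

section \<open>Invariance under central factors\<close>

lemma star_center_left:
  "\<lbrakk>z \<in> mla_center G; x \<in> carrier G; y \<in> carrier G\<rbrakk> \<Longrightarrow> (x \<otimes> z) \<star> y = x \<star> y"
  by (simp add: mla_center_def lie_center_def star_mult_left)

lemma star_center_right:
  "\<lbrakk>z \<in> mla_center G; x \<in> carrier G; y \<in> carrier G\<rbrakk> \<Longrightarrow> x \<star> (y \<otimes> z) = x \<star> y"
  using star_commute_inv[of z x]
  by (simp add: mla_center_def lie_center_def star_mult_right)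

lemma commutator_center:
  assumes "z \<in> mla_center G" "w \<in> mla_center G" "x \<in> carrier G" "y \<in> carrier G"
  shows "(x \<otimes> z) \<otimes> (y \<otimes> w) \<otimes> inv (x \<otimes> z) \<otimes> inv (y \<otimes> w) = x \<otimes> y \<otimes> inv x \<otimes> inv y"
proof -
  have c: "z \<in> carrier G" "w \<in> carrier G"
      "\<And>u. u \<in> carrier G \<Longrightarrow> z \<otimes> u = u \<otimes> z" "\<And>u. u \<in> carrier G \<Longrightarrow> w \<otimes> u = u \<otimes> w"
    using assms by (auto simp: mla_center_def group_center_def)
  have "(x \<otimes> z) \<otimes> (y \<otimes> w) \<otimes> inv (x \<otimes> z) \<otimes> inv (y \<otimes> w) =
      x \<otimes> (z \<otimes> (y \<otimes> (w \<otimes> (inv z \<otimes> (inv x \<otimes> (inv w \<otimes> inv y))))))"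
    using assms c(1,2) by (simp add: inv_mult_group m_assoc)
  \<comment> \<open>One swap carries \<open>z\<close> to the far right, a second one brings it back
    to stand directly after \<open>inv z\<close>. The bracketing selects the product that
    \<open>subst\<close> rewrites. The same two moves then remove \<open>w\<close>.\<close>
  also have "\<dots> = x \<otimes> ((y \<otimes> (w \<otimes> (inv z \<otimes> (inv x \<otimes> (inv w \<otimes> inv y))))) \<otimes> z)"
    using assms c(1,2) by (subst c(3)) simp_all
  also have "\<dots> = x \<otimes> (y \<otimes> (w \<otimes> (inv z \<otimes> ((inv x \<otimes> (inv w \<otimes> inv y)) \<otimes> z))))"
    using assms c(1,2) by (simp add: m_assoc)
  also have "\<dots> = x \<otimes> (y \<otimes> (w \<otimes> (inv x \<otimes> (inv w \<otimes> inv y))))"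
    using assms c(1,2) by (subst c(3)[symmetric]) (simp_all add: mult_inv_cancel)
  also have "\<dots> = x \<otimes> (y \<otimes> ((inv x \<otimes> (inv w \<otimes> inv y)) \<otimes> w))"
    using assms c(1,2) by (subst c(4)) simp_all
  also have "\<dots> = x \<otimes> (y \<otimes> (inv x \<otimes> (inv w \<otimes> (inv y \<otimes> w))))"
    using assms c(1,2) by (simp add: m_assoc)
  also have "\<dots> = x \<otimes> y \<otimes> inv x \<otimes> inv y"
    using assms c(1,2) by (subst c(4)[symmetric]) (simp_all add: mult_inv_cancel m_assoc)
  finally show ?thesis .
qed

section \<open>Homomorphisms on commutator ideals\<close>

lemma mla_hom_preimage_subgroup:
  assumes h: "h \<in> mla_hom G K" and K: "group K" and S: "subgroup S K"
  shows "subgroup {x \<in> carrier G. h x \<in> S} G"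
proof -
  interpret h: group_hom G K h
    using h K by (rule mla_hom_group_hom)
  interpret S: subgroup S K by fact
  show ?thesis
    by (rule subgroupI) auto
qed

text \<open>Keeping \<open>A\<close> and \<open>A'\<close> as parameters lets one statement serve
  for both \<open>\<^sup>M[F,F]\<close> and \<open>\<^sup>M[R,F]\<close>, the two ideals from which
  the multiplier is formed.\<close>

lemma mla_hom_commutator:
  assumes h: "h \<in> mla_hom G K" and K: "mult_lie_algebra K"
    and A: "A \<subseteq> carrier G" "mla_ideal A' K" "h ` A \<subseteq> A'"
    and x: "x \<in> mla_commutator G A (carrier G)"
  shows "h x \<in> mla_commutator K A' (carrier K)"
proof -
  interpret K: mult_lie_algebra K by fact
  interpret h: group_hom G K h
    using h K.is_group by (rule mla_hom_group_hom)
  interpret A': mla_ideal A' K by fact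
  have "mla_commutator G A (carrier G) \<subseteq> {x \<in> carrier G. h x \<in> mla_commutator K A' (carrier K)}"
  proof (rule mla_commutator_least)
    show "subgroup {x \<in> carrier G. h x \<in> mla_commutator K A' (carrier K)} G"
      using h K.is_group K.mla_commutator_subgroup[OF A(2)] by (rule mla_hom_preimage_subgroup)
    fix a b assume ab: "a \<in> A" "b \<in> carrier G"
    then have a: "a \<in> carrier G" "h a \<in> A'"
      using A by auto
    show "a \<star> b \<in> {x \<in> carrier G. h x \<in> mla_commutator K A' (carrier K)}"
      using ab a A'.subset by (simp add: mla_hom_star[OF h] K.mla_commutator_star)
    show "a \<otimes> b \<otimes> inv a \<otimes> inv b \<in> {x \<in> carrier G. h x \<in> mla_commutator K A' (carrier K)}"
      using ab a A'.subset by (simp add: K.mla_commutator_commutator)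
  qed
  then show ?thesis
    using x by auto
qed

text \<open>Central factors cancel in \<open>\<star>\<close> and in group commutators.\<close>

lemma mla_hom_eq_on_commutator:
  assumes E: "mult_lie_algebra E" and h: "h \<in> mla_hom G E" and k: "k \<in> mla_hom G E"
    and central: "\<And>x. x \<in> carrier G \<Longrightarrow> \<exists>z \<in> mla_center E. h x = k x \<otimes>\<^bsub>E\<^esub> z"
    and x: "x \<in> mla_commutator G (carrier G) (carrier G)"
  shows "h x = k x"
proof -
  interpret E: mult_lie_algebra E by fact
  interpret h: group_hom G E h
    using h E.is_group by (rule mla_hom_group_hom)
  interpret k: group_hom G E k
    using k E.is_group by (rule mla_hom_group_hom)
  have "mla_commutator G (carrier G) (carrier G) \<subseteq> {x \<in> carrier G. h x = k x}"
  proof (rule mla_commutator_least)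
    show "subgroup {x \<in> carrier G. h x = k x} G"
      by (rule subgroupI) auto
    fix a b assume ab: "a \<in> carrier G" "b \<in> carrier G"
    obtain z w where zw: "z \<in> mla_center E" "h a = k a \<otimes>\<^bsub>E\<^esub> z"
        "w \<in> mla_center E" "h b = k b \<otimes>\<^bsub>E\<^esub> w"
      using central ab by meson
    have "z \<in> carrier E" "w \<in> carrier E"
      using zw by (auto simp: mla_center_def lie_center_def)
    then show "a \<star> b \<in> {x \<in> carrier G. h x = k x}"
      using ab zw by (simp add: mla_hom_star[OF h] mla_hom_star[OF k] E.star_center_left E.star_center_right)
    show "a \<otimes> b \<otimes> inv a \<otimes> inv b \<in> {x \<in> carrier G. h x = k x}"
      using ab zw E.commutator_center[of z w "k a" "k b"] by simp
  qed
  then show ?thesis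
    using x by auto
qed

text \<open>Since \<open>g\<close> lies over \<open>p\<close>, each
  \<open>inv y \<otimes> g y\<close> is in the kernel of \<open>p\<close> and becomes central modulo
  the ideal in the conclusion. There the projection and its composite with \<open>g\<close> differ
  by central factors, so they agree on commutators. The intended \<open>g\<close> is a round trip
  between two free presentations.\<close>

lemma endomorphism_over_on_commutator:
  assumes H: "mult_lie_algebra H" and p: "p \<in> mla_hom G H" and g: "g \<in> mla_hom G G"
    and over: "\<And>x. x \<in> carrier G \<Longrightarrow> p (g x) = p x"
    and x: "x \<in> mla_commutator G (carrier G) (carrier G)"
  shows "g x \<otimes> inv x \<in> mla_commutator G (kernel G H p) (carrier G)"
proof -
  let ?R = "kernel G H p" and ?I = "mla_commutator G (kernel G H p) (carrier G)"
  interpret H: mult_lie_algebra H by fact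
  interpret p: group_hom G H p
    using p H.is_group by (rule mla_hom_group_hom)
  have R: "mla_ideal ?R G"
    using p H by (rule kernel_ideal)
  \<comment> \<open>The extreme case of \<open>ideal_between\<close>, with the lower bound itself as
    the subgroup.\<close>
  have I: "mla_ideal ?I G"
    by (rule ideal_between[OF R mla_commutator_subgroup[OF R] order.refl mla_commutator_subset_ideal[OF R]])
  interpret I: mla_ideal ?I G by fact
  have gc: "g y \<in> carrier G" if "y \<in> carrier G" for y
    using g that by (rule mla_hom_closed)
  have xc: "x \<in> carrier G"
    using x subgroup.subset[OF mla_commutator_subgroup[OF carrier_ideal]] by blast
  have "((\<lambda>y. ?I #> y) \<circ> g) x = (\<lambda>y. ?I #> y) x"
  proof (rule mla_hom_eq_on_commutator[OF I.quotient_is_mla _ I.quotient_hom _ x])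
    show "(\<lambda>y. ?I #> y) \<circ> g \<in> mla_hom G (G Mod\<^sub>M ?I)"
      using g I.quotient_hom by (rule mla_hom_compose)
    fix y assume y: "y \<in> carrier G"
    then have "inv y \<otimes> g y \<in> ?R"
      using over[OF y] gc by (simp add: kernel_def)
    then have "?I #> (inv y \<otimes> g y) \<in> mla_center (G Mod\<^sub>M ?I)"
      by (rule coset_in_center[OF R I order.refl])
    moreover have "?I #> g y = (?I #> y) \<otimes>\<^bsub>G Mod\<^sub>M ?I\<^esub> (?I #> (inv y \<otimes> g y))"
      using y gc by (simp add: I.quotient_mult mult_inv_cancel)
    ultimately show "\<exists>z\<in>mla_center (G Mod\<^sub>M ?I).
        ((\<lambda>y. ?I #> y) \<circ> g) y = (?I #> y) \<otimes>\<^bsub>G Mod\<^sub>M ?I\<^esub> z"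
      by auto
  qed
  then show ?thesis
    using xc gc by (simp add: I.coset_eq_iff)
qed

end

section \<open>Splitting off a complement\<close>

text \<open>Values are plain integers and not elements of a group record, so that
  \<open>dvd\<close>, \<open>div\<close> and \<open>mod\<close> apply to them directly.\<close>

locale int_character = group G for G (structure) +
  fixes \<chi> :: "'a \<Rightarrow> int"
  assumes char_mult: "\<lbrakk>x \<in> carrier G; y \<in> carrier G\<rbrakk> \<Longrightarrow> \<chi> (x \<otimes> y) = \<chi> x + \<chi> y"
begin

lemma char_one: "\<chi> \<one> = 0"
  using char_mult[of \<one> \<one>] by simp

lemma char_inv: "x \<in> carrier G \<Longrightarrow> \<chi> (inv x) = - \<chi> x"
  using char_mult[of x "inv x"] by (simp add: char_one)

lemma char_int_pow:
  assumes "x \<in> carrier G"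
  shows "\<chi> (x [^] (k::int)) = k * \<chi> x"
proof -
  have *: "\<chi> (x [^] n) = int n * \<chi> x" for n :: nat
    by (induction n) (use assms in \<open>simp_all add: char_one char_mult algebra_simps\<close>)
  show ?thesis
  proof (cases "k < 0")
    case True
    then have "\<chi> (x [^] k) = - \<chi> (x [^] nat (- k))"
      using assms by (simp add: int_pow_def2[of G x k] char_inv)
    also have "\<dots> = k * \<chi> x"
      using True by (simp only: *) simp
    finally show ?thesis .
  next
    case False
    then have "\<chi> (x [^] k) = \<chi> (x [^] nat k)"
      by (simp only: int_pow_def2[of G x k] if_False)
    also have "\<dots> = k * \<chi> x"
      using False by (simp only: *) simp
    finally show ?thesis .
  qed
qed

text \<open>The image of \<open>B\<close> is a subgroup of the integers, generated by its least
  positive value, if there is one. If the character vanishes on \<open>B\<close>, the choice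
  \<open>a = \<one>\<close> ensures that adjoining the powers of \<open>a\<close> adds
  nothing.\<close>

lemma char_image_generator:
  assumes B: "subgroup B G"
  shows "\<exists>a\<in>B. (\<forall>b\<in>B. \<chi> a dvd \<chi> b) \<and> (\<chi> a = 0 \<longrightarrow> a = \<one>)"
proof (cases "\<forall>b\<in>B. \<chi> b = 0")
  case True
  then show ?thesis
    using subgroup.one_closed[OF B] by auto
next
  case False
  then obtain b where b: "b \<in> B" "\<chi> b \<noteq> 0" by blast
  define P where "P n \<longleftrightarrow> 0 < n \<and> (\<exists>a\<in>B. \<chi> a = int n)" for n
  \<comment> \<open>One of \<open>b\<close> and \<open>inv b\<close> has a positive value.\<close>
  have "P (nat \<bar>\<chi> b\<bar>)"
    using b subgroup.m_inv_closed[OF B b(1)] char_inv[OF subgroup.mem_carrier[OF B b(1)]]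
    by (cases "\<chi> b < 0") (auto simp: P_def intro: bexI[of _ b] bexI[of _ "inv b"])
  then have least: "P (LEAST n. P n)"
    by (rule LeastI)
  then obtain a where a: "a \<in> B" "\<chi> a = int (LEAST n. P n)" "\<chi> a > 0"
    by (auto simp: P_def)
  have "\<chi> a dvd \<chi> c" if c: "c \<in> B" for c
  proof -
    \<comment> \<open>Division with remainder inside \<open>B\<close>: the value of
      \<open>?c\<close> is the remainder, which is below the least positive value and hence
      zero.\<close>
    let ?c = "c \<otimes> a [^] (- (\<chi> c div \<chi> a))"
    have "?c \<in> B"
      using B a c subgroup_int_pow_closed[OF B a(1)] by (simp add: subgroup.m_closed)
    moreover have "\<chi> ?c = \<chi> c mod \<chi> a"
      using subgroup.mem_carrier[OF B] a c
      by (simp add: char_mult char_int_pow minus_div_mult_eq_mod)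
    moreover have "\<not> P (nat (\<chi> c mod \<chi> a))"
      using a(2,3) by (intro not_less_Least) (simp add: nat_less_iff)
    moreover have "0 \<le> \<chi> c mod \<chi> a"
      using a(3) by (rule pos_mod_sign)
    ultimately have "\<chi> c mod \<chi> a = 0"
      unfolding P_def by (metis nat_0_le order_le_less zero_less_nat_eq)
    then show ?thesis
      by auto
  qed
  then show ?thesis
    using a by (intro bexI[of _ a]) auto
qed

end

text \<open>For \<open>I\<close> trivial and \<open>B\<close> central this says that the common kernel of finitely many
  characters \<open>B \<rightarrow> \<int>\<close> is a direct factor of \<open>B\<close>.  Each step of the induction enlarges a
  complement \<open>S\<close> inside the kernel of the new character by the powers of an element \<open>a\<close> on
  which that character generates its image.\<close>

lemma (in group) exists_complement_of_characters:
  assumes "finite \<Xi>"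
    and "\<And>\<chi>. \<chi> \<in> \<Xi> \<Longrightarrow> int_character G \<chi>"
    and "subgroup I G" and "\<And>\<chi> x. \<lbrakk>\<chi> \<in> \<Xi>; x \<in> I\<rbrakk> \<Longrightarrow> \<chi> x = 0"
    and "subgroup B G" and "I \<subseteq> B"
    and "\<And>b g. \<lbrakk>b \<in> B; g \<in> carrier G\<rbrakk> \<Longrightarrow> b \<otimes> g \<otimes> inv b \<otimes> inv g \<in> I"
  shows "\<exists>S. subgroup S G \<and> I \<subseteq> S \<and> S \<subseteq> B \<and> (\<forall>s\<in>S. (\<forall>\<chi>\<in>\<Xi>. \<chi> s = 0) \<longrightarrow> s \<in> I) \<and>
    (\<forall>b\<in>B. \<exists>s\<in>S. \<exists>k\<in>B. (\<forall>\<chi>\<in>\<Xi>. \<chi> k = 0) \<and> b = s \<otimes> k)"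
  using assms
proof (induction \<Xi> arbitrary: B rule: finite_induct)
  case empty
  have "\<forall>b\<in>B. \<exists>s\<in>I. \<exists>k\<in>B. b = s \<otimes> k"
    using subgroup.one_closed[OF empty(2)] subgroup.mem_carrier[OF empty(4)] l_one by metis
  then show ?case
    using empty by (intro exI[of _ I]) simp
next
  case (insert \<psi> \<Xi>)
  interpret \<psi>: int_character G \<psi>
    using insert.prems(1) by simp
  interpret I: subgroup I G by (rule insert.prems(2))
  interpret B: subgroup B G by (rule insert.prems(4))
  define B0 where "B0 = {b \<in> B. \<psi> b = 0}"
  have "subgroup B0 G"
    by (rule subgroupI)
      (auto simp: B0_def \<psi>.char_inv \<psi>.char_mult intro: exI[of _ \<one>] \<psi>.char_one)
  moreover have "I \<subseteq> B0"
    using insert.prems(3,5) by (auto simp: B0_def)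
  ultimately obtain S0 where S0: "subgroup S0 G" "I \<subseteq> S0" "S0 \<subseteq> B0"
      and S0_I: "\<And>s. \<lbrakk>s \<in> S0; \<forall>\<chi>\<in>\<Xi>. \<chi> s = 0\<rbrakk> \<Longrightarrow> s \<in> I"
      and S0_sum: "\<And>b. b \<in> B0 \<Longrightarrow> \<exists>s\<in>S0. \<exists>k\<in>B0. (\<forall>\<chi>\<in>\<Xi>. \<chi> k = 0) \<and> b = s \<otimes> k"
    using insert.IH[of B0] insert.prems by (auto simp: B0_def)
  interpret S0: subgroup S0 G by (rule S0(1))
  obtain a where a: "a \<in> B" "\<And>b. b \<in> B \<Longrightarrow> \<psi> a dvd \<psi> b" "\<psi> a = 0 \<Longrightarrow> a = \<one>"
    using \<psi>.char_image_generator[OF insert.prems(4)] by blast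
  have ac: "a \<in> carrier G"
    using a(1) by (rule B.mem_carrier)
  \<comment> \<open>\<open>S0\<close> is obtained only as a subgroup, but commutators of
    \<open>B\<close> with \<open>G\<close> lie in \<open>I \<subseteq> S0\<close>, so it is
    normal.\<close>
  have conj: "g \<otimes> s \<otimes> inv g \<in> S0" if "g \<in> carrier G" "s \<in> S0" for g s
  proof -
    have "s \<in> B"
      using that(2) S0(3) by (auto simp: B0_def)
    then have "inv (s \<otimes> g \<otimes> inv s \<otimes> inv g) \<in> S0"
      using that S0(2) insert.prems(6) by blast
    then have "inv (s \<otimes> g \<otimes> inv s \<otimes> inv g) \<otimes> s \<in> S0"
      using that(2) by (rule S0.m_closed)
    then show ?thesis
      using that by (simp add: inv_mult_group m_assoc)
  qed
  \<comment> \<open>Normality of \<open>S0\<close> makes these products a subgroup although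
    \<open>G\<close> need not be abelian. The set \<open>UNIV :: int set\<close> fixes the type of
    the overloaded exponent.\<close>
  define S where "S = {s \<otimes> a [^] k |s k. s \<in> S0 \<and> k \<in> (UNIV :: int set)}"
  have S_I: "s \<otimes> a [^] (k::int) \<in> S" if "s \<in> S0" for s k
    using that by (auto simp: S_def)
  have pow_comm: "a [^] k \<otimes> s = (a [^] k \<otimes> s \<otimes> inv (a [^] k)) \<otimes> a [^] k"
    if "s \<in> S0" for s and k :: int
    using that ac by (simp add: m_assoc)
  have "subgroup S G"
  proof (rule subgroupI)
    show "S \<subseteq> carrier G"
      using ac by (auto simp: S_def)
    show "S \<noteq> {}"
      using S_I[OF S0.one_closed] by blast
    fix x assume "x \<in> S"
    then obtain s and k :: int where x: "s \<in> S0" "x = s \<otimes> a [^] k"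
      by (auto simp: S_def)
    have "inv x = a [^] (- k) \<otimes> inv s"
      using x ac by (simp add: inv_mult_group int_pow_neg)
    also have "\<dots> = (a [^] (- k) \<otimes> inv s \<otimes> inv (a [^] (- k))) \<otimes> a [^] (- k)"
      using x by (intro pow_comm) simp
    also have "\<dots> \<in> S"
      using x ac by (intro S_I conj) simp_all
    finally show "inv x \<in> S" .
    fix y assume "y \<in> S"
    then obtain t and l :: int where y: "t \<in> S0" "y = t \<otimes> a [^] l"
      by (auto simp: S_def)
    have "x \<otimes> y = s \<otimes> ((a [^] k \<otimes> t) \<otimes> a [^] l)"
      using x y ac by (simp add: m_assoc)
    also have "\<dots> = s \<otimes> (((a [^] k \<otimes> t \<otimes> inv (a [^] k)) \<otimes> a [^] k) \<otimes> a [^] l)"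
      using pow_comm[OF y(1), of k] by simp
    also have "\<dots> = (s \<otimes> (a [^] k \<otimes> t \<otimes> inv (a [^] k))) \<otimes> a [^] (k + l)"
      using x y ac by (simp add: m_assoc int_pow_mult mult_inv_cancel)
    also have "\<dots> \<in> S"
      using x y ac by (intro S_I S0.m_closed conj) simp_all
    finally show "x \<otimes> y \<in> S" .
  qed
  moreover have "S0 \<subseteq> S"
  proof
    fix s assume s: "s \<in> S0"
    then show "s \<in> S"
      using S_I[OF s, of 0] by simp
  qed
  then have "I \<subseteq> S"
    using S0(2) by blast
  moreover have "S \<subseteq> B"
    using S0(3) subgroup_int_pow_closed[OF insert.prems(4) a(1)] by (auto simp: S_def B0_def)
  moreover have "\<forall>s\<in>S. (\<forall>\<chi>\<in>insert \<psi> \<Xi>. \<chi> s = 0) \<longrightarrow> s \<in> I"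
  proof (intro ballI impI)
    fix x assume "x \<in> S" and zero: "\<forall>\<chi>\<in>insert \<psi> \<Xi>. \<chi> x = 0"
    then obtain s and k :: int where x: "s \<in> S0" "x = s \<otimes> a [^] k"
      by (auto simp: S_def)
    have "\<psi> x = \<psi> s + k * \<psi> a"
      using x ac by (simp add: \<psi>.char_mult \<psi>.char_int_pow)
    moreover have "\<psi> s = 0" "\<psi> x = 0"
      using x S0(3) zero by (auto simp: B0_def)
    \<comment> \<open>From \<open>k * \<psi> a = 0\<close> either \<open>k = 0\<close> or
      \<open>\<psi> a = 0\<close>; in the second case \<open>a\<close> was chosen to be
      \<open>\<one>\<close>. Either way the power of \<open>a\<close> disappears.\<close>
    ultimately have "k = 0 \<or> a = \<one>"
      using a(3) by auto
    then have "x = s"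
      using x by auto
    then show "x \<in> I"
      using S0_I[OF x(1)] zero by simp
  qed
  moreover have "\<forall>b\<in>B. \<exists>s\<in>S. \<exists>k\<in>B. (\<forall>\<chi>\<in>insert \<psi> \<Xi>. \<chi> k = 0) \<and> b = s \<otimes> k"
  proof
    fix b assume b: "b \<in> B"
    obtain q where q: "\<psi> b = \<psi> a * q"
      using a(2)[OF b] by (auto elim: dvdE)
    \<comment> \<open>Removing the right power of \<open>a\<close> brings \<open>b\<close> into the
      kernel of \<open>\<psi>\<close>, where the induction hypothesis decomposes it. Afterwards
      \<open>a [^] q\<close> is moved past the \<open>S0\<close> part by
      \<open>pow_comm\<close>.\<close>
    have "a [^] (- q) \<otimes> b \<in> B0"
      using b q ac subgroup_int_pow_closed[OF insert.prems(4) a(1)]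
      by (simp add: B0_def \<psi>.char_mult \<psi>.char_int_pow)
    then obtain s k where sk: "s \<in> S0" "k \<in> B0" "\<forall>\<chi>\<in>\<Xi>. \<chi> k = 0" "a [^] (- q) \<otimes> b = s \<otimes> k"
      using S0_sum by blast
    have kc: "k \<in> carrier G"
      using sk(2) by (simp add: B0_def)
    have "b = a [^] q \<otimes> (a [^] (- q) \<otimes> b)"
      using b ac by (simp add: int_pow_neg mult_inv_cancel)
    also have "\<dots> = (a [^] q \<otimes> s) \<otimes> k"
      using sk kc ac by (simp add: m_assoc)
    also have "\<dots> = ((a [^] q \<otimes> s \<otimes> inv (a [^] q)) \<otimes> a [^] q) \<otimes> k"
      using pow_comm[OF sk(1), of q] by simp
    finally have "b = ((a [^] q \<otimes> s \<otimes> inv (a [^] q)) \<otimes> a [^] q) \<otimes> k" .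
    moreover have "(a [^] q \<otimes> s \<otimes> inv (a [^] q)) \<otimes> a [^] q \<in> S"
      using sk ac by (intro S_I conj) simp_all
    moreover have "k \<in> B" "\<forall>\<chi>\<in>insert \<psi> \<Xi>. \<chi> k = 0"
      using sk by (auto simp: B0_def)
    ultimately show "\<exists>s\<in>S. \<exists>k\<in>B. (\<forall>\<chi>\<in>insert \<psi> \<Xi>. \<chi> k = 0) \<and> b = s \<otimes> k"
      by blast
  qed
  ultimately show ?case
    by blast
qed

section \<open>The abelianization of a free multiplicative Lie algebra\<close>

text \<open>With the trivial \<open>\<star>\<close> the integers become a target for
  \<open>free_mla_extension\<close>, which then provides the coordinate functions of the
  abelianization.\<close>

definition int_mla :: "int mla"
  where "int_mla = \<lparr>carrier = UNIV, mult = (+), one = 0, star = (\<lambda>_ _. 0)\<rparr>"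

lemma int_mla_simps [simp]:
  "carrier int_mla = UNIV" "x \<otimes>\<^bsub>int_mla\<^esub> y = x + y" "\<one>\<^bsub>int_mla\<^esub> = 0" "x \<star>\<^bsub>int_mla\<^esub> y = 0"
  by (simp_all add: int_mla_def)

lemma mult_lie_algebra_int_mla: "mult_lie_algebra int_mla"
proof -
  interpret group int_mla
    by (rule groupI) (auto intro: exI[of _ "- x" for x])
  have "inv\<^bsub>int_mla\<^esub> x = - x" for x
    by (rule inv_equality) simp_all
  then show ?thesis
    by unfold_locales (simp_all add: conjugate_def)
qed

lemma int_character_of_mla_hom:
  "\<lbrakk>group G; \<chi> \<in> mla_hom G int_mla\<rbrakk> \<Longrightarrow> int_character G \<chi>"
  by (simp add: int_character_def int_character_axioms_def mla_hom_mult)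

lemma (in mult_lie_algebra) mla_hom_int_commutator:
  assumes \<chi>: "\<chi> \<in> mla_hom G int_mla" and x: "x \<in> mla_commutator G (carrier G) (carrier G)"
  shows "\<chi> x = 0"
proof -
  interpret Z: mult_lie_algebra int_mla by (rule mult_lie_algebra_int_mla)
  interpret \<chi>: int_character G \<chi>
    using is_group \<chi> by (rule int_character_of_mla_hom)
  have "mla_commutator G (carrier G) (carrier G) \<subseteq> {x \<in> carrier G. \<chi> x = 0}"
  proof (rule mla_commutator_least)
    show "subgroup {x \<in> carrier G. \<chi> x = 0} G"
      using mla_hom_preimage_subgroup[OF \<chi> Z.is_group Z.triv_subgroup] by simp
  qed (simp_all add: mla_hom_star[OF \<chi>] \<chi>.char_mult \<chi>.char_inv)
  then show ?thesis
    using x by auto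
qed

text \<open>The homomorphism \<open>w \<mapsto> \<Prod>\<^sub>x x\<^bsup>\<chi> x w\<^esup>\<close> to the abelianization agrees with the quotient map on
  the generators.\<close>

lemma free_mla_commutator_characters:
  assumes "finite X"
  shows "\<exists>\<Xi>. finite \<Xi> \<and> \<Xi> \<subseteq> mla_hom (free_mla X) int_mla \<and>
    (\<forall>w\<in>carrier (free_mla X). (\<forall>\<chi>\<in>\<Xi>. \<chi> w = 0) \<longrightarrow>
      w \<in> mla_commutator (free_mla X) (carrier (free_mla X)) (carrier (free_mla X)))"
proof -
  define F where "F = free_mla X"
  let ?M = "mla_commutator F (carrier F) (carrier F)"
  interpret F: mult_lie_algebra F
    unfolding F_def by (rule mult_lie_algebra_free_mla)
  interpret Z: mult_lie_algebra int_mla by (rule mult_lie_algebra_int_mla)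
  interpret M: mla_ideal ?M F
    by (rule F.ideal_between[OF F.carrier_ideal F.mla_commutator_subgroup[OF F.carrier_ideal]
        order.refl F.mla_commutator_subset_ideal[OF F.carrier_ideal]])
  define V where "V = F Mod\<^sub>M ?M"
  interpret V: mult_lie_algebra V
    unfolding V_def by (rule M.quotient_is_mla)
  define q where "q x = ?M #>\<^bsub>F\<^esub> x" for x
  have q: "q \<in> mla_hom F V"
    unfolding q_def V_def by (rule M.quotient_hom)
  have V_carrier: "carrier V = q ` carrier F"
    by (simp add: V_def q_def M.quotient_carrier)
  have q_closed: "q x \<in> carrier V" if "x \<in> carrier F" for x
    using that by (simp add: V_carrier)
  have q_one_iff: "q x = \<one>\<^bsub>V\<^esub> \<longleftrightarrow> x \<in> ?M" if "x \<in> carrier F" for x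
    unfolding q_def V_def using that by (rule M.coset_eq_one_iff)
  have V_comm: "q x \<otimes>\<^bsub>V\<^esub> q y = q y \<otimes>\<^bsub>V\<^esub> q x" if xy: "x \<in> carrier F" "y \<in> carrier F" for x y
  proof -
    have "(x \<otimes>\<^bsub>F\<^esub> y) \<otimes>\<^bsub>F\<^esub> inv\<^bsub>F\<^esub> (y \<otimes>\<^bsub>F\<^esub> x) \<in> ?M"
      using xy F.mla_commutator_commutator[OF order.refl order.refl xy]
      by (simp add: F.inv_mult_group F.m_assoc)
    then show ?thesis
      using xy by (simp add: q_def V_def M.quotient_mult M.coset_eq_iff)
  qed
  interpret V: comm_group V
    by (rule V.group_comm_groupI) (auto simp: V_carrier V_comm)
  have gen: "free_gen X x \<in> carrier F" if "x \<in> X" for x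
    using that by (simp add: F_def free_gen_def free_mla_class_in)
  have "\<exists>\<chi> \<in> mla_hom F int_mla. \<forall>y\<in>X. \<chi> (free_gen X y) = (if y = x then 1 else 0)" for x
    unfolding F_def by (rule Z.free_mla_extension) simp
  then obtain \<chi> where \<chi>: "\<And>x. \<chi> x \<in> mla_hom F int_mla"
      and \<chi>_gen: "\<And>x y. y \<in> X \<Longrightarrow> \<chi> x (free_gen X y) = (if y = x then 1 else 0)"
    by metis
  \<comment> \<open>For infinite \<open>X\<close> this product would take the default value
    \<open>\<one>\<close>; finiteness enters in \<open>\<theta>_gen\<close>, where exactly one
    factor survives.\<close>
  define \<theta> where "\<theta> w = finprod V (\<lambda>x. q (free_gen X x) [^]\<^bsub>V\<^esub> \<chi> x w) X" for w
  have pow: "(\<lambda>x. q (free_gen X x) [^]\<^bsub>V\<^esub> (k x :: int)) \<in> X \<rightarrow> carrier V" for k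
    using gen q_closed by auto
  have \<theta>: "\<theta> \<in> mla_hom F V"
  proof (rule mla_homI)
    have "\<theta> (v \<otimes>\<^bsub>F\<^esub> w) = \<theta> v \<otimes>\<^bsub>V\<^esub> \<theta> w" if "v \<in> carrier F" "w \<in> carrier F" for v w
    proof -
      have "\<theta> (v \<otimes>\<^bsub>F\<^esub> w) =
          finprod V (\<lambda>x. q (free_gen X x) [^]\<^bsub>V\<^esub> \<chi> x v \<otimes>\<^bsub>V\<^esub> q (free_gen X x) [^]\<^bsub>V\<^esub> \<chi> x w) X"
        unfolding \<theta>_def
        by (rule V.finprod_cong')
          (use that gen q_closed in \<open>auto simp: mla_hom_mult[OF \<chi>] V.int_pow_mult\<close>)
      also have "\<dots> = \<theta> v \<otimes>\<^bsub>V\<^esub> \<theta> w"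
        unfolding \<theta>_def by (rule V.finprod_multf[OF pow pow])
      finally show ?thesis .
    qed
    moreover have "\<theta> w \<in> carrier V" for w
      unfolding \<theta>_def by (rule V.finprod_closed[OF pow])
    ultimately show "\<theta> \<in> hom F V"
      by (simp add: hom_def)
    fix v w assume vw: "v \<in> carrier F" "w \<in> carrier F"
    have "\<theta> (v \<star>\<^bsub>F\<^esub> w) = \<one>\<^bsub>V\<^esub>"
      unfolding \<theta>_def using vw by (simp add: mla_hom_star[OF \<chi>])
    moreover have "x \<star>\<^bsub>V\<^esub> y = \<one>\<^bsub>V\<^esub>" if "x \<in> carrier V" "y \<in> carrier V" for x y
    proof -
      obtain a b where ab: "a \<in> carrier F" "b \<in> carrier F" "x = q a" "y = q b"
        using \<open>x \<in> carrier V\<close> \<open>y \<in> carrier V\<close> V_carrier by auto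
      then have "x \<star>\<^bsub>V\<^esub> y = q (a \<star>\<^bsub>F\<^esub> b)"
        by (simp add: mla_hom_star[OF q])
      then show ?thesis
        using ab F.mla_commutator_star[OF order.refl order.refl ab(1,2)] q_one_iff by simp
    qed
    ultimately show "\<theta> (v \<star>\<^bsub>F\<^esub> w) = \<theta> v \<star>\<^bsub>V\<^esub> \<theta> w"
      using \<open>\<And>w. \<theta> w \<in> carrier V\<close> by simp
  qed
  have \<theta>_gen: "\<theta> (free_gen X y) = q (free_gen X y)" if "y \<in> X" for y
  proof -
    have "\<theta> (free_gen X y) = finprod V (\<lambda>x. if y = x then q (free_gen X x) else \<one>\<^bsub>V\<^esub>) X"
      unfolding \<theta>_def
      by (rule V.finprod_cong') (use that gen q_closed in \<open>auto simp: \<chi>_gen\<close>)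
    also have "\<dots> = q (free_gen X y)"
      using that assms gen q_closed by (intro V.finprod_singleton) auto
    finally show ?thesis .
  qed
  have \<theta>_eq: "\<theta> w = q w" if "w \<in> carrier F" for w
    using V.free_mla_extension_unique[of \<theta> X q w] \<theta> q \<theta>_gen that by (simp add: F_def)
  have "w \<in> ?M" if "w \<in> carrier F" "\<forall>x\<in>X. \<chi> x w = 0" for w
  proof -
    have "\<theta> w = \<one>\<^bsub>V\<^esub>"
      unfolding \<theta>_def by (rule V.finprod_one_eqI) (simp add: that(2))
    then show ?thesis
      using that(1) by (simp add: \<theta>_eq q_one_iff)
  qed
  then show ?thesis
    using assms \<chi> by (intro exI[of _ "\<chi> ` X"]) (auto simp: F_def)
qed

section \<open>Existence of a stem cover\<close>

text \<open>Free algebras are projective: choose preimages under \<open>p\<close> of the images of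
  the generators and extend. The composite agrees with \<open>\<pi>\<close> on generators, hence
  everywhere.\<close>

lemma free_mla_lift:
  assumes E: "mult_lie_algebra E" and G: "mult_lie_algebra G"
    and p: "p \<in> mla_hom E G" "p ` carrier E = carrier G" and \<pi>: "\<pi> \<in> mla_hom (free_mla X) G"
  shows "\<exists>\<alpha> \<in> mla_hom (free_mla X) E. \<forall>w\<in>carrier (free_mla X). p (\<alpha> w) = \<pi> w"
proof -
  interpret E: mult_lie_algebra E by fact
  interpret G: mult_lie_algebra G by fact
  have gen: "free_gen X x \<in> carrier (free_mla X)" if "x \<in> X" for x
    using that by (simp add: free_gen_def free_mla_class_in)
  have "\<exists>e\<in>carrier E. p e = \<pi> (free_gen X x)" if "x \<in> X" for x
  proof -
    have "\<pi> (free_gen X x) \<in> p ` carrier E"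
      using mla_hom_closed[OF \<pi> gen[OF that]] p(2) by simp
    then show ?thesis
      by auto
  qed
  then obtain f where f: "\<And>x. x \<in> X \<Longrightarrow> f x \<in> carrier E" "\<And>x. x \<in> X \<Longrightarrow> p (f x) = \<pi> (free_gen X x)"
    by metis
  then obtain \<alpha> where \<alpha>: "\<alpha> \<in> mla_hom (free_mla X) E" "\<And>x. x \<in> X \<Longrightarrow> \<alpha> (free_gen X x) = f x"
    using E.free_mla_extension[of f X] by (auto simp: image_subset_iff)
  have "(p \<circ> \<alpha>) w = \<pi> w" if "w \<in> carrier (free_mla X)" for w
    by (rule G.free_mla_extension_unique[OF mla_hom_compose[OF \<alpha>(1) p(1)] \<pi> _ that])
      (simp add: \<alpha>(2) f(2))
  then show ?thesis
    using \<alpha>(1) by auto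
qed

text \<open>The common kernel of the chosen characters is exactly \<open>\<^sup>M[F,F]\<close>. The
  complement of that kernel in \<open>R\<close> relative to \<open>\<^sup>M[R,F]\<close> therefore
  satisfies the last two clauses, which later give injectivity and surjectivity of the map from the
  multiplier to \<open>R/S\<close>.\<close>

lemma free_mla_relation_complement:
  assumes X: "finite X" and R: "mla_ideal R (free_mla X)"
  defines "F \<equiv> free_mla X"
  shows "\<exists>S. subgroup S F \<and> mla_commutator F R (carrier F) \<subseteq> S \<and> S \<subseteq> R \<and>
    S \<inter> mla_commutator F (carrier F) (carrier F) \<subseteq> mla_commutator F R (carrier F) \<and>
    R \<subseteq> S <#>\<^bsub>F\<^esub> (R \<inter> mla_commutator F (carrier F) (carrier F))"
proof -
  let ?I = "mla_commutator F R (carrier F)" and ?M = "mla_commutator F (carrier F) (carrier F)"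
  interpret F: mult_lie_algebra F
    unfolding F_def by (rule mult_lie_algebra_free_mla)
  interpret R: mla_ideal R F
    using R by (simp add: F_def)
  have RF: "mla_ideal R F"
    using R by (simp add: F_def)
  obtain \<Xi> where \<Xi>: "finite \<Xi>" "\<Xi> \<subseteq> mla_hom F int_mla"
      and \<Xi>_M: "\<And>w. \<lbrakk>w \<in> carrier F; \<forall>\<chi>\<in>\<Xi>. \<chi> w = 0\<rbrakk> \<Longrightarrow> w \<in> ?M"
    using free_mla_commutator_characters[OF X] unfolding F_def by blast
  have zero: "\<chi> x = 0" if "\<chi> \<in> \<Xi>" "x \<in> ?M" for \<chi> x
    using that \<Xi>(2) F.mla_hom_int_commutator by blast
  have "\<exists>S. subgroup S F \<and> ?I \<subseteq> S \<and> S \<subseteq> R \<and> (\<forall>s\<in>S. (\<forall>\<chi>\<in>\<Xi>. \<chi> s = 0) \<longrightarrow> s \<in> ?I) \<and>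
      (\<forall>b\<in>R. \<exists>s\<in>S. \<exists>k\<in>R. (\<forall>\<chi>\<in>\<Xi>. \<chi> k = 0) \<and> b = s \<otimes>\<^bsub>F\<^esub> k)"
  proof (rule F.exists_complement_of_characters[OF \<Xi>(1)])
    show "int_character F \<chi>" if "\<chi> \<in> \<Xi>" for \<chi>
      using that \<Xi>(2) int_character_of_mla_hom[OF F.is_group] by blast
    show "\<chi> x = 0" if "\<chi> \<in> \<Xi>" "x \<in> ?I" for \<chi> x
      using that zero F.mla_commutator_mono[OF R.subset] by blast
    show "b \<otimes>\<^bsub>F\<^esub> g \<otimes>\<^bsub>F\<^esub> inv\<^bsub>F\<^esub> b \<otimes>\<^bsub>F\<^esub> inv\<^bsub>F\<^esub> g \<in> ?I" if "b \<in> R" "g \<in> carrier F" for b g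
      using that R.subset by (intro F.mla_commutator_commutator) auto
  qed (rule F.mla_commutator_subgroup[OF RF] F.mla_commutator_subset_ideal[OF RF]
      R.subgroup_axioms)+
  then obtain S where S: "subgroup S F" "?I \<subseteq> S" "S \<subseteq> R"
      and S_I: "\<forall>s\<in>S. (\<forall>\<chi>\<in>\<Xi>. \<chi> s = 0) \<longrightarrow> s \<in> ?I"
      and S_R: "\<forall>r\<in>R. \<exists>s\<in>S. \<exists>k\<in>R. (\<forall>\<chi>\<in>\<Xi>. \<chi> k = 0) \<and> r = s \<otimes>\<^bsub>F\<^esub> k"
    by (elim exE conjE)
  have "S \<inter> ?M \<subseteq> ?I"
    using S_I zero by blast
  moreover have "R \<subseteq> S <#>\<^bsub>F\<^esub> (R \<inter> ?M)"
  proof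
    fix r assume "r \<in> R"
    then obtain s k where "s \<in> S" "k \<in> R" "\<forall>\<chi>\<in>\<Xi>. \<chi> k = 0" "r = s \<otimes>\<^bsub>F\<^esub> k"
      using S_R by blast
    moreover have "k \<in> ?M"
      using calculation by (intro \<Xi>_M R.mem_carrier) auto
    ultimately show "r \<in> S <#>\<^bsub>F\<^esub> (R \<inter> ?M)"
      unfolding set_mult_def by blast
  qed
  ultimately show ?thesis
    using S by blast
qed

text \<open>Lifts \<open>\<alpha>: F' \<rightarrow> F\<close> and \<open>\<beta>: F \<rightarrow> F'\<close> over \<open>G\<close> are mutually inverse on \<open>\<^sup>M[F,F] \<inter> R\<close> modulo
  \<open>\<^sup>M[R,F]\<close>, so \<open>\<alpha>\<close> followed by the projection to \<open>F/S\<close> maps the multiplier computed in \<open>F'\<close>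
  onto \<open>R/S\<close>.\<close>

lemma complement_kernel_iso_schur_multiplier:
  assumes G: "mult_lie_algebra G"
    and pres: "free_presentation X \<pi> G" and pres': "free_presentation X' \<pi>' G"
  defines "F \<equiv> free_mla X"
  defines "R \<equiv> kernel F G \<pi>"
  assumes S: "subgroup S F" "mla_commutator F R (carrier F) \<subseteq> S" "S \<subseteq> R"
    and S_M: "S \<inter> mla_commutator F (carrier F) (carrier F) \<subseteq> mla_commutator F R (carrier F)"
    and S_R: "R \<subseteq> S <#>\<^bsub>F\<^esub> (R \<inter> mla_commutator F (carrier F) (carrier F))"
    and p: "p \<in> mla_hom (F Mod\<^sub>M S) G" "\<And>x. x \<in> carrier F \<Longrightarrow> p (S #>\<^bsub>F\<^esub> x) = \<pi> x"
  shows "(F Mod\<^sub>M S)\<lparr>carrier := kernel (F Mod\<^sub>M S) G p\<rparr> \<cong>\<^sub>M schur_multiplier X' \<pi>' G"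
proof -
  define F' where "F' = free_mla X'"
  define R' where "R' = kernel F' G \<pi>'"
  define N where "N = kernel (F Mod\<^sub>M S) G p"
  let ?I = "mla_commutator F R (carrier F)" and ?M = "mla_commutator F (carrier F) (carrier F)"
  let ?I' = "mla_commutator F' R' (carrier F')" and ?M' = "mla_commutator F' (carrier F') (carrier F')"
  define T' where "T' = ?M' \<inter> R'"
  interpret G: mult_lie_algebra G by fact
  interpret F: mult_lie_algebra F
    unfolding F_def by (rule mult_lie_algebra_free_mla)
  interpret F': mult_lie_algebra F'
    unfolding F'_def by (rule mult_lie_algebra_free_mla)
  have \<pi>: "\<pi> \<in> mla_hom F G" "\<pi> ` carrier F = carrier G"
    using pres by (auto simp: free_presentation_def F_def)
  have \<pi>': "\<pi>' \<in> mla_hom F' G" "\<pi>' ` carrier F' = carrier G"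
    using pres' by (auto simp: free_presentation_def F'_def)
  have mem_R: "x \<in> R \<longleftrightarrow> x \<in> carrier F \<and> \<pi> x = \<one>\<^bsub>G\<^esub>" for x
    by (simp add: R_def kernel_def)
  have mem_R': "x \<in> R' \<longleftrightarrow> x \<in> carrier F' \<and> \<pi>' x = \<one>\<^bsub>G\<^esub>" for x
    by (simp add: R'_def kernel_def)
  have mem_N: "u \<in> N \<longleftrightarrow> u \<in> carrier (F Mod\<^sub>M S) \<and> p u = \<one>\<^bsub>G\<^esub>" for u
    by (simp add: N_def kernel_def)
  have R: "mla_ideal R F"
    unfolding R_def using \<pi>(1) G by (rule F.kernel_ideal)
  have R': "mla_ideal R' F'"
    unfolding R'_def using \<pi>'(1) G by (rule F'.kernel_ideal)
  interpret S: mla_ideal S F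
    using R S by (rule F.ideal_between)
  interpret E: mult_lie_algebra "F Mod\<^sub>M S"
    by (rule S.quotient_is_mla)
  obtain \<alpha> where \<alpha>: "\<alpha> \<in> mla_hom F' F" "\<And>x. x \<in> carrier F' \<Longrightarrow> \<pi> (\<alpha> x) = \<pi>' x"
    using free_mla_lift[OF F.mult_lie_algebra_axioms G \<pi>] \<pi>'(1) unfolding F'_def by blast
  obtain \<beta> where \<beta>: "\<beta> \<in> mla_hom F F'" "\<And>x. x \<in> carrier F \<Longrightarrow> \<pi>' (\<beta> x) = \<pi> x"
    using free_mla_lift[OF F'.mult_lie_algebra_axioms G \<pi>'] \<pi>(1) unfolding F_def by blast
  have \<alpha>c: "\<alpha> x \<in> carrier F" if "x \<in> carrier F'" for x
    using \<alpha>(1) that by (rule mla_hom_closed)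
  have \<beta>c: "\<beta> x \<in> carrier F'" if "x \<in> carrier F" for x
    using \<beta>(1) that by (rule mla_hom_closed)
  have \<alpha>R: "\<alpha> ` R' \<subseteq> R" and \<beta>R: "\<beta> ` R \<subseteq> R'"
    using \<alpha>(2) \<alpha>c \<beta>(2) \<beta>c by (auto simp: mem_R mem_R')
  have R'c: "R' \<subseteq> carrier F'" and Rc: "R \<subseteq> carrier F"
    by (auto simp: mem_R mem_R')
  have \<alpha>M: "\<alpha> x \<in> ?M" if "x \<in> ?M'" for x
    using F'.mla_hom_commutator[OF \<alpha>(1) F.mult_lie_algebra_axioms order.refl F.carrier_ideal _ that] \<alpha>c
    by blast
  have \<beta>M: "\<beta> x \<in> ?M'" if "x \<in> ?M" for x
    using F.mla_hom_commutator[OF \<beta>(1) F'.mult_lie_algebra_axioms order.refl F'.carrier_ideal _ that] \<beta>c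
    by blast
  have \<alpha>I: "\<alpha> x \<in> ?I" if "x \<in> ?I'" for x
    using F'.mla_hom_commutator[OF \<alpha>(1) F.mult_lie_algebra_axioms R'c R \<alpha>R that] .
  have \<beta>I: "\<beta> x \<in> ?I'" if "x \<in> ?I" for x
    using F.mla_hom_commutator[OF \<beta>(1) F'.mult_lie_algebra_axioms Rc R' \<beta>R that] .
  have \<alpha>\<beta>: "\<alpha> (\<beta> x) \<otimes>\<^bsub>F\<^esub> inv\<^bsub>F\<^esub> x \<in> ?I" if "x \<in> ?M" for x
    using F.endomorphism_over_on_commutator[OF G \<pi>(1) mla_hom_compose[OF \<beta>(1) \<alpha>(1)] _ that]
      \<alpha>(2) \<beta>(2) \<beta>c by (simp add: R_def)
  have \<beta>\<alpha>: "\<beta> (\<alpha> x) \<otimes>\<^bsub>F'\<^esub> inv\<^bsub>F'\<^esub> x \<in> ?I'" if "x \<in> ?M'" for x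
    using F'.endomorphism_over_on_commutator[OF G \<pi>'(1) mla_hom_compose[OF \<alpha>(1) \<beta>(1)] _ that]
      \<alpha>(2) \<beta>(2) \<alpha>c by (simp add: R'_def)
  have I': "subgroup ?I' F'"
    using R' by (rule F'.mla_commutator_subgroup)
  have M': "subgroup ?M' F'"
    using F'.carrier_ideal by (rule F'.mla_commutator_subgroup)
  have I'_T': "?I' \<subseteq> T'"
    using F'.mla_commutator_mono[OF R'c] F'.mla_commutator_subset_ideal[OF R'] by (auto simp: T'_def)
  have T'c: "T' \<subseteq> carrier F'"
    using R'c by (auto simp: T'_def)
  have T'_mla: "mult_lie_algebra (F'\<lparr>carrier := T'\<rparr>)"
  proof (rule F'.subalgebra_is_mla)
    show "subgroup T' F'"
      unfolding T'_def using M' normal_imp_subgroup[OF mla_ideal.axioms(1)[OF R']]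
      by (rule F'.subgroups_Inter_pair)
    fix x y assume "x \<in> T'" "y \<in> T'"
    then show "x \<star>\<^bsub>F'\<^esub> y \<in> T'"
      using T'c mla_ideal.star_ideal[OF R', of x y] F'.mla_commutator_star[of "carrier F'" "carrier F'" x y]
      by (auto simp: T'_def)
  qed
  interpret T': mult_lie_algebra "F'\<lparr>carrier := T'\<rparr>" by (rule T'_mla)
  have N_ideal: "mla_ideal N (F Mod\<^sub>M S)"
    unfolding N_def using p(1) G by (rule E.kernel_ideal)
  have N_mla: "mult_lie_algebra ((F Mod\<^sub>M S)\<lparr>carrier := N\<rparr>)"
  proof (rule E.subalgebra_is_mla)
    show "subgroup N (F Mod\<^sub>M S)"
      by (rule normal_imp_subgroup) (rule mla_ideal.axioms(1)[OF N_ideal])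
    show "x \<star>\<^bsub>F Mod\<^sub>M S\<^esub> y \<in> N" if "x \<in> N" "y \<in> N" for x y
      using that by (intro mla_ideal.star_ideal[OF N_ideal]) (auto simp: mem_N)
  qed
  define h where "h x = S #>\<^bsub>F\<^esub> \<alpha> x" for x
  have h: "h \<in> mla_hom (F'\<lparr>carrier := T'\<rparr>) ((F Mod\<^sub>M S)\<lparr>carrier := N\<rparr>)"
  proof (rule mla_homI)
    have "h x \<in> N" if "x \<in> T'" for x
      using that T'c \<alpha>c \<alpha>(2)
      by (auto simp: h_def mem_N S.quotient_carrier p(2) mem_R' T'_def)
    then show "h \<in> hom (F'\<lparr>carrier := T'\<rparr>) ((F Mod\<^sub>M S)\<lparr>carrier := N\<rparr>)"
      using T'c \<alpha>c by (auto simp: hom_def h_def mla_hom_mult[OF \<alpha>(1)] subset_iff S.quotient_mult)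
  qed (use T'c \<alpha>c in \<open>auto simp: h_def mla_hom_star[OF \<alpha>(1)] subset_iff S.quotient_star\<close>)
  have surj: "h ` carrier (F'\<lparr>carrier := T'\<rparr>) = carrier ((F Mod\<^sub>M S)\<lparr>carrier := N\<rparr>)"
  proof
    show "h ` carrier (F'\<lparr>carrier := T'\<rparr>) \<subseteq> carrier ((F Mod\<^sub>M S)\<lparr>carrier := N\<rparr>)"
      using mla_hom_closed[OF h] by blast
    show "carrier ((F Mod\<^sub>M S)\<lparr>carrier := N\<rparr>) \<subseteq> h ` carrier (F'\<lparr>carrier := T'\<rparr>)"
    proof
      fix u assume "u \<in> carrier ((F Mod\<^sub>M S)\<lparr>carrier := N\<rparr>)"
      then have "u \<in> N" by simp
      then obtain r where r: "r \<in> carrier F" "u = S #>\<^bsub>F\<^esub> r" "\<pi> r = \<one>\<^bsub>G\<^esub>"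
        using p(2) by (auto simp: mem_N S.quotient_carrier)
      then have "r \<in> R"
        by (simp add: mem_R)
      \<comment> \<open>The factor \<open>s\<close> vanishes modulo \<open>S\<close>, and
        \<open>t\<close> equals \<open>\<alpha> (\<beta> t)\<close> modulo \<open>S\<close>, so
        \<open>\<beta> t\<close> is the preimage sought.\<close>
      then obtain s t where st: "s \<in> S" "t \<in> R" "t \<in> ?M" "r = s \<otimes>\<^bsub>F\<^esub> t"
        using S_R unfolding set_mult_def by blast
      have tc: "t \<in> carrier F"
        using st(2) Rc by blast
      have "\<alpha> (\<beta> t) \<otimes>\<^bsub>F\<^esub> inv\<^bsub>F\<^esub> t \<in> S"
        using \<alpha>\<beta>[OF st(3)] S(2) by blast
      then have "h (\<beta> t) = S #>\<^bsub>F\<^esub> t"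
        using tc \<alpha>c \<beta>c by (simp add: h_def S.coset_eq_iff)
      also have "\<dots> = u"
        using r st tc by (simp add: S.coset_eq_iff F.inv_mult_group F.mult_inv_cancel)
      finally have "u = h (\<beta> t)" by simp
      moreover have "\<beta> t \<in> T'"
        using st \<beta>R \<beta>M by (auto simp: T'_def)
      ultimately show "u \<in> h ` carrier (F'\<lparr>carrier := T'\<rparr>)"
        by simp
    qed
  qed
  have ker: "kernel (F'\<lparr>carrier := T'\<rparr>) ((F Mod\<^sub>M S)\<lparr>carrier := N\<rparr>) h = ?I'"
  proof -
    have "h x = \<one>\<^bsub>F Mod\<^sub>M S\<^esub> \<longleftrightarrow> x \<in> ?I'" if x: "x \<in> T'" for x
    proof
      have xc: "x \<in> carrier F'"
        using x T'c by blast
      show "h x = \<one>\<^bsub>F Mod\<^sub>M S\<^esub>" if "x \<in> ?I'"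
        using \<alpha>I[OF that] S(2) xc \<alpha>c by (auto simp: h_def S.coset_eq_one_iff)
      assume "h x = \<one>\<^bsub>F Mod\<^sub>M S\<^esub>"
      then have "\<alpha> x \<in> S"
        using xc \<alpha>c by (simp add: h_def S.coset_eq_one_iff)
      \<comment> \<open>Here the trivial intersection is used: \<open>\<alpha> x\<close> lies in
        \<open>S\<close> and in \<open>?M\<close>. Applying \<open>\<beta>\<close> returns to
        \<open>?I'\<close>, and \<open>\<beta> (\<alpha> x)\<close> differs from \<open>x\<close>
        only by an element of \<open>?I'\<close>.\<close>
      then have "\<alpha> x \<in> ?I"
        using S_M x \<alpha>M by (auto simp: T'_def)
      then have \<beta>\<alpha>_I': "\<beta> (\<alpha> x) \<in> ?I'"
        by (rule \<beta>I)
      have "inv\<^bsub>F'\<^esub> (\<beta> (\<alpha> x) \<otimes>\<^bsub>F'\<^esub> inv\<^bsub>F'\<^esub> x) \<otimes>\<^bsub>F'\<^esub> \<beta> (\<alpha> x) \<in> ?I'"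
        using x \<beta>\<alpha>[of x] \<beta>\<alpha>_I' subgroup.m_closed[OF I'] subgroup.m_inv_closed[OF I']
        by (simp add: T'_def)
      then show "x \<in> ?I'"
        using xc \<alpha>c \<beta>c by (simp add: F'.inv_mult_group F'.m_assoc)
    qed
    then show ?thesis
      using I'_T' by (auto simp: kernel_def)
  qed
  have "F'\<lparr>carrier := T'\<rparr> Mod\<^sub>M ?I' \<cong>\<^sub>M (F Mod\<^sub>M S)\<lparr>carrier := N\<rparr>"
    using T'.first_isomorphism[OF h N_mla surj] unfolding ker .
  moreover have "mult_lie_algebra (F'\<lparr>carrier := T'\<rparr> Mod\<^sub>M ?I')"
    using mla_ideal.quotient_is_mla[OF T'.kernel_ideal[OF h N_mla]] unfolding ker .
  ultimately have "(F Mod\<^sub>M S)\<lparr>carrier := N\<rparr> \<cong>\<^sub>M F'\<lparr>carrier := T'\<rparr> Mod\<^sub>M ?I'"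
    by (rule mla_is_iso_sym[rotated])
  then show ?thesis
    by (simp add: schur_multiplier_def Let_def N_def T'_def R'_def F'_def)
qed

theorem theorem4p14:
  fixes G :: "('a, 'b) mla_scheme"
  assumes "mult_lie_algebra G" and "finite (carrier G)"
  shows "\<exists>G' :: 'a mla_term set set mla. is_cover G' G"
proof -
  interpret G: mult_lie_algebra G by fact
  obtain \<pi> where pres: "free_presentation (carrier G) \<pi> G"
    using G.ex_free_presentation by blast
  define F where "F = free_mla (carrier G)"
  define R where "R = kernel F G \<pi>"
  let ?M = "mla_commutator F (carrier F) (carrier F)"
  interpret F: mult_lie_algebra F
    unfolding F_def by (rule mult_lie_algebra_free_mla)
  have \<pi>: "\<pi> \<in> mla_hom F G" "\<pi> ` carrier F = carrier G"
    using pres by (auto simp: free_presentation_def F_def)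
  have mem_R: "x \<in> R \<longleftrightarrow> x \<in> carrier F \<and> \<pi> x = \<one>\<^bsub>G\<^esub>" for x
    by (simp add: R_def kernel_def)
  have R: "mla_ideal R F"
    unfolding R_def using \<pi>(1) assms(1) by (rule F.kernel_ideal)
  obtain S where S: "subgroup S F" "mla_commutator F R (carrier F) \<subseteq> S" "S \<subseteq> R"
      and S_M: "S \<inter> ?M \<subseteq> mla_commutator F R (carrier F)" and S_R: "R \<subseteq> S <#>\<^bsub>F\<^esub> (R \<inter> ?M)"
    using free_mla_relation_complement[OF assms(2)] R unfolding F_def by metis
  have S_ideal: "mla_ideal S F"
    using R S by (rule F.ideal_between)
  interpret S: mla_ideal S F by (rule S_ideal)
  define E where "E = F Mod\<^sub>M S"
  interpret E: mult_lie_algebra E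
    unfolding E_def by (rule S.quotient_is_mla)
  obtain p where p: "p \<in> mla_hom E G" "\<And>x. x \<in> carrier F \<Longrightarrow> p (S #>\<^bsub>F\<^esub> x) = \<pi> x"
    using S.quotient_factor[OF \<pi>(1) G.is_group] S(3) unfolding R_def E_def by blast
  define N where "N = kernel E G p"
  have N: "\<exists>r\<in>R. u = S #>\<^bsub>F\<^esub> r" if "u \<in> N" for u
    using that p(2) by (auto simp: N_def kernel_def E_def S.quotient_carrier mem_R)
  have "p ` carrier E = carrier G"
    using \<pi>(2) by (simp add: E_def S.quotient_carrier image_image p(2))
  moreover have "N \<subseteq> mla_center E"
    using N F.coset_in_center[OF R S_ideal S(2)] unfolding E_def by blast
  ultimately have "central_extension N E p G"
    using p(1) assms(1) E.mult_lie_algebra_axioms by (simp add: central_extension_def N_def)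
  moreover have "N \<subseteq> mla_commutator E (carrier E) (carrier E)"
  proof
    fix u assume "u \<in> N"
    then obtain r where r: "r \<in> R" "u = S #>\<^bsub>F\<^esub> r"
      using N by blast
    then obtain s t where st: "s \<in> S" "t \<in> R" "t \<in> ?M" "r = s \<otimes>\<^bsub>F\<^esub> t"
      using S_R unfolding set_mult_def by blast
    have "t \<in> carrier F"
      using st(2) by (simp add: mem_R)
    \<comment> \<open>Modulo \<open>S\<close> only the factor \<open>t\<close> from the commutator
      ideal remains, and the projection carries it to the commutator ideal of
      \<open>E\<close>.\<close>
    then have "u = S #>\<^bsub>F\<^esub> t"
      using r st by (simp add: S.coset_eq_iff F.m_assoc)
    then show "u \<in> mla_commutator E (carrier E) (carrier E)"
      using F.mla_hom_commutator[OF S.quotient_hom _ order.refl, of "carrier E" t] st(3)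
        E.mult_lie_algebra_axioms E.carrier_ideal by (auto simp: E_def S.quotient_carrier)
  qed
  ultimately have "stem_extension N E p G"
    by (simp add: stem_extension_def)
  moreover have "E\<lparr>carrier := N\<rparr> \<cong>\<^sub>M schur_multiplier X \<pi>' G"
    if "free_presentation X \<pi>' G" for X :: "'a set" and \<pi>'
    using complement_kernel_iso_schur_multiplier[OF assms(1) pres that, of S p] S S_M S_R p
    by (simp add: F_def R_def E_def N_def)
  ultimately have "stem_cover N E p G"
    by (simp add: stem_cover_def)
  then show ?thesis
    by (auto simp: is_cover_def)
qed

end
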